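(* Let $\mathcal{M}$ be an o-minimal expansion of $(\mathbb{R},<)$. Let $(X,\tau)$ be a definable topological space. The following are equivalent. (1) $(X,\tau)$ is definably separable. (2) $(X,\tau)$ is separable (i.e. it has a countable dense subset). (3) $(X,\tau)$ has the countable chain condition (i.e. there is no uncountable family of pairwise disjoint $\tau$-open sets).
   Context: "Definable" means definable in the structure $\mathcal{M}=(M,\ldots)$, possibly with parameters (here $M=\mathbb{R}$). A family of sets $\{A_b : b\in B\}$ is definable if there is a formula $\varphi(x,y)$ such that $B\subseteq M^{|y|}$ is definable and $A_b=\{a\in M^{|x|} : \mathcal{M}\models\varphi(a,b)\}$ for every $b\in B$. Families are regarded as sets of sets: a family is infinite if it has infinitely many distinct members, and pairwise disjoint if any two distinct members are disjoint. A definable topological space $(X,\tau)$, $X\subseteq M^n$, is a topological space such that there exists a definable family of subsets of $X$ that is a basis for $\tau$. It is definably separable if there exists no infinite definable family of pairwise disjoint $\tau$-open sets. *)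

theory Defs
  imports "HOL-Analysis.Analysis"
begin

text \<open>
  First-order structures expanding \<open>(\<real>,<)\<close>. Function symbols \<open>'f\<close> (constants have arity 0) and
  relation symbols \<open>'r\<close> come from arbitrary types; equality and \<open><\<close> are logical primitives of
  the syntax. A symbol's interpretation matters only on lists of the length given by its arity.
\<close>

record ('f, 'r) real_structure =
  fun_arity :: "'f \<Rightarrow> nat"
  rel_arity :: "'r \<Rightarrow> nat"
  fun_interp :: "'f \<Rightarrow> real list \<Rightarrow> real"
  rel_interp :: "'r \<Rightarrow> real list \<Rightarrow> bool"

datatype 'f trm = Var nat | Fn 'f "'f trm list"

text \<open>
  Variables are de Bruijn indices: \<open>Var i\<close> denotes entry \<open>i\<close> of the environment list, and
  \<open>Ex\<close> binds index 0, shifting the free variables up by one.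
\<close>

datatype ('f, 'r) fmla =
    Eq "'f trm" "'f trm"
  | Less "'f trm" "'f trm"
  | Rel 'r "'f trm list"
  | Neg "('f, 'r) fmla"
  | Conj "('f, 'r) fmla" "('f, 'r) fmla"
  | Ex "('f, 'r) fmla"

text \<open>\<open>wf_trm M k t\<close> and \<open>wf_fmla M k \<phi>\<close>: arities are respected and all free variables are
  among the indices \<open>0, \<dots>, k - 1\<close>.\<close>

fun wf_trm :: "('f, 'r) real_structure \<Rightarrow> nat \<Rightarrow> 'f trm \<Rightarrow> bool" where
  "wf_trm M k (Var i) \<longleftrightarrow> i < k"
| "wf_trm M k (Fn f ts) \<longleftrightarrow> length ts = fun_arity M f \<and> (\<forall>t\<in>set ts. wf_trm M k t)"

fun wf_fmla :: "('f, 'r) real_structure \<Rightarrow> nat \<Rightarrow> ('f, 'r) fmla \<Rightarrow> bool" where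
  "wf_fmla M k (Eq s t) \<longleftrightarrow> wf_trm M k s \<and> wf_trm M k t"
| "wf_fmla M k (Less s t) \<longleftrightarrow> wf_trm M k s \<and> wf_trm M k t"
| "wf_fmla M k (Rel r ts) \<longleftrightarrow> length ts = rel_arity M r \<and> (\<forall>t\<in>set ts. wf_trm M k t)"
| "wf_fmla M k (Neg \<phi>) \<longleftrightarrow> wf_fmla M k \<phi>"
| "wf_fmla M k (Conj \<phi> \<psi>) \<longleftrightarrow> wf_fmla M k \<phi> \<and> wf_fmla M k \<psi>"
| "wf_fmla M k (Ex \<phi>) \<longleftrightarrow> wf_fmla M (Suc k) \<phi>"

fun eval_trm :: "('f, 'r) real_structure \<Rightarrow> real list \<Rightarrow> 'f trm \<Rightarrow> real" where
  "eval_trm M e (Var i) = e ! i"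
| "eval_trm M e (Fn f ts) = fun_interp M f (map (eval_trm M e) ts)"

fun sat :: "('f, 'r) real_structure \<Rightarrow> real list \<Rightarrow> ('f, 'r) fmla \<Rightarrow> bool" where
  "sat M e (Eq s t) \<longleftrightarrow> eval_trm M e s = eval_trm M e t"
| "sat M e (Less s t) \<longleftrightarrow> eval_trm M e s < eval_trm M e t"
| "sat M e (Rel r ts) \<longleftrightarrow> rel_interp M r (map (eval_trm M e) ts)"
| "sat M e (Neg \<phi>) \<longleftrightarrow> \<not> sat M e \<phi>"
| "sat M e (Conj \<phi> \<psi>) \<longleftrightarrow> sat M e \<phi> \<and> sat M e \<psi>"
| "sat M e (Ex \<phi>) \<longleftrightarrow> (\<exists>x. sat M (x # e) \<phi>)"

text \<open>Points of \<open>\<real>\<^sup>n\<close> are real lists of length \<open>n\<close>, since statements about definable families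
  quantify over the dimension of the index set. The list \<open>c\<close> holds the parameters.\<close>

definition definable_set :: "('f, 'r) real_structure \<Rightarrow> nat \<Rightarrow> real list set \<Rightarrow> bool" where
  "definable_set M n A \<longleftrightarrow>
     (\<exists>\<phi> c. wf_fmla M (n + length c) \<phi> \<and> A = {a. length a = n \<and> sat M (a @ c) \<phi>})"

definition definable_family :: "('f, 'r) real_structure \<Rightarrow> nat \<Rightarrow> real list set set \<Rightarrow> bool" where
  "definable_family M n \<A> \<longleftrightarrow>
     (\<exists>m B \<phi> c. definable_set M m B \<and> wf_fmla M (n + m + length c) \<phi> \<and>
        \<A> = (\<lambda>b. {a. length a = n \<and> sat M (a @ b @ c) \<phi>}) ` B)"

text \<open>Every definable subset of \<open>\<real>\<close> is a finite union of points and open intervals with endpoints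
  in \<open>\<real> \<union> {-\<infinity>, \<infinity>}\<close>.\<close>

definition o_minimal :: "('f, 'r) real_structure \<Rightarrow> bool" where
  "o_minimal M \<longleftrightarrow>
     (\<forall>S. definable_set M 1 ((\<lambda>x. [x]) ` S) \<longrightarrow>
        (\<exists>\<C>. finite \<C> \<and> S = \<Union>\<C> \<and>
           (\<forall>C\<in>\<C>. (\<exists>a. C = {a}) \<or> (\<exists>l u :: ereal. C = {x. l < ereal x \<and> ereal x < u}))))"

text \<open>The underlying set \<open>X \<subseteq> \<real>\<^sup>n\<close> is \<open>topspace \<tau>\<close>.\<close>

definition definable_topological_space ::
    "('f, 'r) real_structure \<Rightarrow> nat \<Rightarrow> real list topology \<Rightarrow> bool" where
  "definable_topological_space M n \<tau> \<longleftrightarrow>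
     topspace \<tau> \<subseteq> {a. length a = n} \<and>
     (\<exists>\<B>. definable_family M n \<B> \<and> (\<forall>A\<in>\<B>. openin \<tau> A) \<and>
        (\<forall>U. openin \<tau> U \<longrightarrow> (\<exists>\<B>'\<subseteq>\<B>. U = \<Union>\<B>')))"

definition definably_separable ::
    "('f, 'r) real_structure \<Rightarrow> nat \<Rightarrow> real list topology \<Rightarrow> bool" where
  "definably_separable M n \<tau> \<longleftrightarrow>
     \<not> (\<exists>\<A>. definable_family M n \<A> \<and> infinite \<A> \<and> pairwise disjnt \<A> \<and> (\<forall>A\<in>\<A>. openin \<tau> A))"

definition countable_chain_condition :: "'a topology \<Rightarrow> bool" where
  "countable_chain_condition \<tau> \<longleftrightarrow>
     \<not> (\<exists>\<A>. uncountable \<A> \<and> pairwise disjnt \<A> \<and> (\<forall>A\<in>\<A>. openin \<tau> A))"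

end

theory Submission
  imports Defs
begin

text \<open>
  Call a subset of \<open>\<real>\<^sup>m\<close> large if it is so for the \<open>m\<close>-fold iterated quantifier ``for uncountably many
  reals''. This is \<open>\<sigma>\<close>-additive, and by o-minimality a large definable set contains a rational box,
  while a definable set that is not large is a countable union of definable graphs over coordinate
  hyperplanes. This replaces cell decomposition and dimension theory throughout.

  For a definably separable space one shows, by induction on \<open>m\<close>, that every definable family
  \<open>(U\<^sub>b)\<close> of open sets with \<open>b \<in> \<real>\<^sup>m\<close> has a countable set meeting all its nonempty members. Otherwise one
  may assume that no point \<open>c\<close> lies in \<open>U\<^sub>b\<close> for a large set of \<open>b\<close>. Then, for every \<open>k\<close>, the members
  indexed by a large set of \<open>k\<close>-tuples are shown to have a common point. (For \<open>m = 1\<close> one links two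
  nearby members at a time, because unlinked ones would form an infinite definable disjoint family; for
  \<open>m > 1\<close> one splits off a coordinate and uses the cases \<open>m - 1\<close> and \<open>1\<close>.) As the points range over
  \<open>\<real>\<^sup>n\<close>, a dimension count refutes this once \<open>k = 2\<^sup>n\<close>.

  Conversely, a countable definable family is finite, so the countable chain condition implies
  definable separability.
\<close>

section \<open>Closure properties of definable predicates\<close>

primrec ren_trm :: "(nat \<Rightarrow> nat) \<Rightarrow> 'f trm \<Rightarrow> 'f trm" where
  "ren_trm f (Var i) = Var (f i)"
| "ren_trm f (Fn g ts) = Fn g (map (ren_trm f) ts)"

text \<open>In the \<open>Ex\<close> case the renaming is lifted past the binder: index 0 is the
  bound variable and stays fixed.\<close>

primrec ren_fmla :: "(nat \<Rightarrow> nat) \<Rightarrow> ('f, 'r) fmla \<Rightarrow> ('f, 'r) fmla" where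
  "ren_fmla f (Eq s t) = Eq (ren_trm f s) (ren_trm f t)"
| "ren_fmla f (Less s t) = Less (ren_trm f s) (ren_trm f t)"
| "ren_fmla f (Rel r ts) = Rel r (map (ren_trm f) ts)"
| "ren_fmla f (Neg \<phi>) = Neg (ren_fmla f \<phi>)"
| "ren_fmla f (Conj \<phi> \<psi>) = Conj (ren_fmla f \<phi>) (ren_fmla f \<psi>)"
| "ren_fmla f (Ex \<phi>) = Ex (ren_fmla (case_nat 0 (Suc \<circ> f)) \<phi>)"

lemma wf_ren_trm:
  assumes "wf_trm M k t" "\<And>i. i < k \<Longrightarrow> f i < k'"
  shows "wf_trm M k' (ren_trm f t)"
  using assms by (induction t) auto

lemma eval_ren_trm:
  assumes "wf_trm M k t" "\<And>i. i < k \<Longrightarrow> e' ! f i = e ! i"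
  shows "eval_trm M e' (ren_trm f t) = eval_trm M e t"
  using assms
proof (induction t)
  case (Fn g ts)
  then have "map (eval_trm M e' \<circ> ren_trm f) ts = map (eval_trm M e) ts"
    by (intro map_cong) auto
  then show ?case by (metis eval_trm.simps(2) map_map ren_trm.simps(2))
qed auto

lemma wf_ren_fmla:
  assumes "wf_fmla M k \<phi>" "\<And>i. i < k \<Longrightarrow> f i < k'"
  shows "wf_fmla M k' (ren_fmla f \<phi>)"
  using assms
proof (induction \<phi> arbitrary: k k' f)
  case (Ex \<phi>)
  show ?case
    using Ex.prems by (auto intro!: Ex.IH[where k="Suc k"] split: nat.splits)
qed (auto simp: wf_ren_trm)

lemma sat_ren_fmla:
  assumes "wf_fmla M k \<phi>" "\<And>i. i < k \<Longrightarrow> e' ! f i = e ! i"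
  shows "sat M e' (ren_fmla f \<phi>) \<longleftrightarrow> sat M e \<phi>"
  using assms
proof (induction \<phi> arbitrary: k f e e')
  case (Eq s t)
  then show ?case using eval_ren_trm[of M k] by (auto)
next
  case (Less s t)
  then show ?case using eval_ren_trm[of M k] by (auto)
next
  case (Rel r ts)
  have "map (eval_trm M e' \<circ> ren_trm f) ts = map (eval_trm M e) ts"
    using Rel by (auto intro!: eval_ren_trm)
  then show ?case by (metis map_map ren_fmla.simps(3) sat.simps(3))
next
  case (Ex \<phi>)
  have "sat M (x # e') (ren_fmla (case_nat 0 (Suc \<circ> f)) \<phi>) \<longleftrightarrow> sat M (x # e) \<phi>" for x
    by (rule Ex.IH[where k="Suc k"]) (use Ex.prems in \<open>auto split: nat.splits\<close>)
  then show ?case by simp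
next
  case (Neg \<phi>)
  show ?case using Neg.IH[of k e' f e] Neg.prems by auto
next
  case (Conj \<phi> \<psi>)
  show ?case using Conj.IH(1)[of k e' f e] Conj.IH(2)[of k e' f e] Conj.prems by auto
qed

locale o_minimal_structure =
  fixes M :: "('f, 'r) real_structure"
  assumes o_minimal: "o_minimal M"
begin

text \<open>Definability is attached to predicates, and only their values on lists of length
  \<open>k\<close> count. Closure under the logical operations then takes the form of introduction
  rules that follow the shape of a predicate, with all parameters hidden.\<close>

definition dfn :: "nat \<Rightarrow> (real list \<Rightarrow> bool) \<Rightarrow> bool" where
  "dfn k P \<longleftrightarrow> (\<exists>\<phi> c. wf_fmla M (k + length c) \<phi> \<and> (\<forall>a. length a = k \<longrightarrow> P a = sat M (a @ c) \<phi>))"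

text \<open>Maps whose output coordinates are input coordinates or constants: the substitutions
  that need no function symbols.\<close>

definition sel :: "nat \<Rightarrow> (real list \<Rightarrow> real list) \<Rightarrow> bool" where
  "sel k f \<longleftrightarrow> (\<exists>\<sigma> c. (\<forall>i\<in>set \<sigma>. i < k + length c) \<and>
     (\<forall>a. length a = k \<longrightarrow> f a = map ((!) (a @ c)) \<sigma>))"

definition sel1 :: "nat \<Rightarrow> (real list \<Rightarrow> real) \<Rightarrow> bool" where
  "sel1 k f \<longleftrightarrow> sel k (\<lambda>a. [f a])"

definition dfn2 :: "nat \<Rightarrow> nat \<Rightarrow> (real list \<Rightarrow> real list \<Rightarrow> bool) \<Rightarrow> bool" where
  "dfn2 m k R \<longleftrightarrow> dfn (m + k) (\<lambda>e. R (take m e) (drop m e))"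

lemma dfn_cong:
  assumes "dfn k P" "\<And>a. length a = k \<Longrightarrow> Q a = P a"
  shows "dfn k Q"
  using assms unfolding dfn_def by metis

lemma sel_id: "sel k (\<lambda>a. a)"
  unfolding sel_def
  by (rule exI[of _ "[0..<k]"], rule exI[of _ "[]"]) (auto intro!: nth_equalityI)

lemma sel_const: "sel k (\<lambda>a. c)"
  unfolding sel_def
  by (rule exI[of _ "[k..<k + length c]"], rule exI[of _ c])
     (auto intro!: nth_equalityI simp: nth_append)

lemma sel_drop: assumes "sel k f" shows "sel k (\<lambda>a. drop r (f a))"
proof -
  from assms obtain \<sigma> c where *: "\<forall>i\<in>set \<sigma>. i < k + length c"
    "\<And>a. length a = k \<Longrightarrow> f a = map ((!) (a @ c)) \<sigma>" unfolding sel_def by blast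
  show ?thesis unfolding sel_def
    by (rule exI[of _ "drop r \<sigma>"], rule exI[of _ c]) (use * in \<open>auto simp: drop_map dest: in_set_dropD\<close>)
qed

lemma sel_tl: assumes "sel k f" shows "sel k (\<lambda>a. tl (f a))"
  using sel_drop[OF assms, of 1] by (simp add: drop_Suc)

lemma sel_take: assumes "sel k f" shows "sel k (\<lambda>a. take r (f a))"
proof -
  from assms obtain \<sigma> c where *: "\<forall>i\<in>set \<sigma>. i < k + length c"
    "\<And>a. length a = k \<Longrightarrow> f a = map ((!) (a @ c)) \<sigma>" unfolding sel_def by blast
  show ?thesis unfolding sel_def
    by (rule exI[of _ "take r \<sigma>"], rule exI[of _ c]) (use * in \<open>auto simp: take_map dest: in_set_takeD\<close>)
qed

lemma sel_append: assumes "sel k f" "sel k g" shows "sel k (\<lambda>a. f a @ g a)"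
proof -
  from assms(1) obtain \<sigma> c where 1: "\<forall>i\<in>set \<sigma>. i < k + length c"
    "\<And>a. length a = k \<Longrightarrow> f a = map ((!) (a @ c)) \<sigma>" unfolding sel_def by blast
  from assms(2) obtain \<rho> d where 2: "\<forall>i\<in>set \<rho>. i < k + length d"
    "\<And>a. length a = k \<Longrightarrow> g a = map ((!) (a @ d)) \<rho>" unfolding sel_def by blast
  \<comment> \<open>In the merged parameter list \<open>c @ d\<close> the parameters of the second
    map sit behind \<open>c\<close>, hence the shift by \<open>length c\<close>.\<close>
  let ?h = "\<lambda>i. if i < k then i else i + length c"
  show ?thesis unfolding sel_def
  proof (intro exI[of _ "\<sigma> @ map ?h \<rho>"] exI[of _ "c @ d"] conjI allI impI)
    show "\<forall>i\<in>set (\<sigma> @ map ?h \<rho>). i < k + length (c @ d)" using 1(1) 2(1) by fastforce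
    fix a :: "real list" assume a: "length a = k"
    have "map ((!) (a @ c)) \<sigma> = map ((!) (a @ c @ d)) \<sigma>"
      using 1(1) a by (auto simp: nth_append)
    moreover have "map ((!) (a @ d)) \<rho> = map ((!) (a @ c @ d)) (map ?h \<rho>)"
      using 2(1) a by (auto simp: nth_append)
    ultimately show "f a @ g a = map ((!) (a @ c @ d)) (\<sigma> @ map ?h \<rho>)"
      using 1(2)[OF a] 2(2)[OF a] by simp
  qed
qed

lemma sel_cons: assumes "sel1 k g" "sel k f" shows "sel k (\<lambda>a. g a # f a)"
  using sel_append[OF assms(1)[unfolded sel1_def] assms(2)] by simp

lemma sel1_const: "sel1 k (\<lambda>a. c)"
  unfolding sel1_def by (rule sel_const)

lemma sel1_nth:
  assumes "sel k f" "\<And>a. length a = k \<Longrightarrow> i < length (f a)"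
  shows "sel1 k (\<lambda>a. f a ! i)"
proof -
  have "sel k (\<lambda>a. take 1 (drop i (f a)))" by (intro sel_take sel_drop assms)
  moreover have "take 1 (drop i (f a)) = [f a ! i]" if "length a = k" for a
    using assms(2)[OF that] by (simp add: take_Suc_conv_app_nth)
  ultimately show ?thesis unfolding sel1_def sel_def by auto
qed

lemma sel1_hd:
  assumes "sel k f" "\<And>a. length a = k \<Longrightarrow> 0 < length (f a)"
  shows "sel1 k (\<lambda>a. hd (f a))"
proof -
  have "sel k (\<lambda>a. take 1 (f a))" by (intro sel_take assms)
  moreover have "take 1 (f a) = [hd (f a)]" if "length a = k" for a
    using assms(2)[OF that] by (cases "f a") auto
  ultimately show ?thesis unfolding sel1_def sel_def by auto
qed

text \<open>Each variable of \<open>P\<close> is replaced by the coordinate or constant that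
  \<open>f\<close> puts in its place. So the substitution is a renaming of variables, with the
  parameters of \<open>f\<close> placed before those of \<open>P\<close>.\<close>

lemma dfn_subst:
  assumes "dfn m P" "sel k f" "\<And>a. length a = k \<Longrightarrow> length (f a) = m"
  shows "dfn k (\<lambda>a. P (f a))"
proof -
  from assms(1) obtain \<phi> d where \<phi>: "wf_fmla M (m + length d) \<phi>"
    "\<And>a. length a = m \<Longrightarrow> P a = sat M (a @ d) \<phi>" unfolding dfn_def by blast
  from assms(2) obtain \<sigma> c where f: "\<forall>i\<in>set \<sigma>. i < k + length c"
    "\<And>a. length a = k \<Longrightarrow> f a = map ((!) (a @ c)) \<sigma>" unfolding sel_def by blast
  \<comment> \<open>Any input of length \<open>k\<close> reveals the number of output coordinates;
    the zero list serves.\<close>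
  have m: "length \<sigma> = m" using f(2)[of "replicate k 0"] assms(3)[of "replicate k 0"] by simp
  let ?h = "\<lambda>i. if i < m then \<sigma> ! i else (i - m) + (k + length c)"
  show ?thesis unfolding dfn_def
  proof (intro exI[of _ "ren_fmla ?h \<phi>"] exI[of _ "c @ d"] conjI allI impI)
    show "wf_fmla M (k + length (c @ d)) (ren_fmla ?h \<phi>)"
      using f(1) m by (intro wf_ren_fmla[OF \<phi>(1)]) (auto simp: trans_less_add1 simp flip: add.assoc)
    fix a :: "real list" assume a: "length a = k"
    have "sat M (a @ c @ d) (ren_fmla ?h \<phi>) = sat M (f a @ d) \<phi>"
    proof (rule sat_ren_fmla[OF \<phi>(1)])
      fix i assume i: "i < m + length d"
      show "(a @ c @ d) ! ?h i = (f a @ d) ! i"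
      proof (cases "i < m")
        case True
        then have "\<sigma> ! i < k + length c" using f(1) m by auto
        then show ?thesis using True a m by (auto simp: f(2)[OF a] nth_append)
      next
        case False
        then show ?thesis using assms(3)[OF a] a by (auto simp: nth_append)
      qed
    qed
    then show "P (f a) = sat M (a @ c @ d) (ren_fmla ?h \<phi>)"
      using \<phi>(2)[OF assms(3)[OF a]] by simp
  qed
qed

lemma dfn2_subst:
  assumes "dfn2 m l R" "sel k f" "sel k g"
    "\<And>a. length a = k \<Longrightarrow> length (f a) = m" "\<And>a. length a = k \<Longrightarrow> length (g a) = l"
  shows "dfn k (\<lambda>a. R (f a) (g a))"
  by (rule dfn_cong[OF dfn_subst[OF assms(1)[unfolded dfn2_def] sel_append[OF assms(2,3)]]])
     (simp_all add: assms(4,5))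

lemma dfn_neg: assumes "dfn k P" shows "dfn k (\<lambda>a. \<not> P a)"
proof -
  from assms obtain \<phi> c where "wf_fmla M (k + length c) \<phi>"
    "\<And>a. length a = k \<Longrightarrow> P a = sat M (a @ c) \<phi>" unfolding dfn_def by blast
  then show ?thesis unfolding dfn_def
    by (intro exI[of _ "Neg \<phi>"] exI[of _ c]) auto
qed

lemma dfn_conj: assumes "dfn k P" "dfn k Q" shows "dfn k (\<lambda>a. P a \<and> Q a)"
proof -
  from assms(1) obtain \<phi> c where 1: "wf_fmla M (k + length c) \<phi>"
    "\<And>a. length a = k \<Longrightarrow> P a = sat M (a @ c) \<phi>" unfolding dfn_def by blast
  from assms(2) obtain \<psi> d where 2: "wf_fmla M (k + length d) \<psi>"
    "\<And>a. length a = k \<Longrightarrow> Q a = sat M (a @ d) \<psi>" unfolding dfn_def by blast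
  let ?h = "\<lambda>i. if i < k then i else i + length c"
  show ?thesis unfolding dfn_def
  proof (intro exI[of _ "Conj (ren_fmla id \<phi>) (ren_fmla ?h \<psi>)"] exI[of _ "c @ d"] conjI allI impI)
    show "wf_fmla M (k + length (c @ d)) (Conj (ren_fmla id \<phi>) (ren_fmla ?h \<psi>))"
      by (simp, intro conjI wf_ren_fmla[OF 1(1)] wf_ren_fmla[OF 2(1)]) auto
    fix a :: "real list" assume a: "length a = k"
    have "sat M (a @ c @ d) (ren_fmla id \<phi>) = sat M (a @ c) \<phi>"
      using a by (intro sat_ren_fmla[OF 1(1)]) (auto simp: nth_append)
    moreover have "sat M (a @ c @ d) (ren_fmla ?h \<psi>) = sat M (a @ d) \<psi>"
      using a by (intro sat_ren_fmla[OF 2(1)]) (auto simp: nth_append)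
    ultimately show "(P a \<and> Q a) = sat M (a @ c @ d) (Conj (ren_fmla id \<phi>) (ren_fmla ?h \<psi>))"
      using 1(2)[OF a] 2(2)[OF a] by simp
  qed
qed

lemma dfn_disj: assumes "dfn k P" "dfn k Q" shows "dfn k (\<lambda>a. P a \<or> Q a)"
  using dfn_neg[OF dfn_conj[OF dfn_neg[OF assms(1)] dfn_neg[OF assms(2)]]] by simp

lemma dfn_imp: assumes "dfn k P" "dfn k Q" shows "dfn k (\<lambda>a. P a \<longrightarrow> Q a)"
  unfolding imp_conv_disj by (intro dfn_disj dfn_neg assms)

lemma dfn_ex:
  assumes "dfn (Suc k) (\<lambda>e. P (hd e) (tl e))" shows "dfn k (\<lambda>a. \<exists>x. P x a)"
proof -
  from assms obtain \<phi> c where \<phi>: "wf_fmla M (Suc k + length c) \<phi>"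
    "\<And>a. length a = Suc k \<Longrightarrow> P (hd a) (tl a) = sat M (a @ c) \<phi>" unfolding dfn_def by blast
  have "P x a = sat M (x # a @ c) \<phi>" if "length a = k" for x a
    using \<phi>(2)[of "x # a"] that by simp
  then show ?thesis unfolding dfn_def
    using \<phi>(1) by (intro exI[of _ "Ex \<phi>"] exI[of _ c]) auto
qed

lemma dfn_all:
  assumes "dfn (Suc k) (\<lambda>e. P (hd e) (tl e))" shows "dfn k (\<lambda>a. \<forall>x. P x a)"
  using dfn_neg[OF dfn_ex[of k "\<lambda>x a. \<not> P x a", OF dfn_neg[OF assms]]] by simp

lemma dfn_exs:
  assumes "dfn (m + k) (\<lambda>e. P (take m e) (drop m e))"
  shows "dfn k (\<lambda>a. \<exists>b. length b = m \<and> P b a)"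
  using assms
proof (induction m arbitrary: P)
  case 0
  then show ?case by simp
next
  case (Suc m)
  have "dfn k (\<lambda>a. \<exists>b. length b = m \<and> (\<exists>x. P (x # b) a))"
  proof (rule Suc.IH, rule dfn_ex)
    show "dfn (Suc (m + k)) (\<lambda>e. P (hd e # take m (tl e)) (drop m (tl e)))"
    proof (rule dfn_cong)
      show "dfn (Suc (m + k)) (\<lambda>e. P (take (Suc m) e) (drop (Suc m) e))"
        using Suc.prems by simp
      fix e :: "real list" assume "length e = Suc (m + k)"
      then show "P (hd e # take m (tl e)) (drop m (tl e)) = P (take (Suc m) e) (drop (Suc m) e)"
        by (cases e) auto
    qed
  qed
  then show ?case
  proof (rule dfn_cong)
    fix a :: "real list"
    show "(\<exists>b. length b = Suc m \<and> P b a) = (\<exists>b. length b = m \<and> (\<exists>x. P (x # b) a))"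
      by (metis length_Suc_conv)
  qed
qed

lemma dfn_alls:
  assumes "dfn (m + k) (\<lambda>e. P (take m e) (drop m e))"
  shows "dfn k (\<lambda>a. \<forall>b. length b = m \<longrightarrow> P b a)"
  using dfn_neg[OF dfn_exs[of m k "\<lambda>x a. \<not> P x a", OF dfn_neg[OF assms]]] by simp

lemma dfn_less: assumes "sel1 k f" "sel1 k g" shows "dfn k (\<lambda>a. f a < g a)"
proof -
  have "dfn 2 (\<lambda>e. e ! 0 < e ! 1)"
    unfolding dfn_def by (rule exI[of _ "Less (Var 0) (Var 1)"], rule exI[of _ "[]"]) auto
  from dfn_subst[OF this sel_cons[OF assms(1) assms(2)[unfolded sel1_def]]]
  show ?thesis by simp
qed

lemma dfn_eq: assumes "sel1 k f" "sel1 k g" shows "dfn k (\<lambda>a. f a = g a)"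
  using dfn_conj[OF dfn_neg[OF dfn_less[OF assms]] dfn_neg[OF dfn_less[OF assms(2,1)]]]
  by (rule dfn_cong) auto

text \<open>The syntax has no truth values, so a comparison of two constants chosen according to
  \<open>C\<close> stands in for them.\<close>

lemma dfn_const: "dfn k (\<lambda>a. C)"
proof -
  have "dfn k (\<lambda>a. (0::real) < (if C then 1 else 0))"
    by (intro dfn_less sel1_const)
  then show ?thesis by (rule dfn_cong) auto
qed

lemma dfn_ball:
  assumes "finite S" "\<And>s. s \<in> S \<Longrightarrow> dfn k (P s)" shows "dfn k (\<lambda>a. \<forall>s\<in>S. P s a)"
  using assms
proof (induction S)
  case empty
  then show ?case by (simp add: dfn_const)
next
  case (insert s S)
  then show ?case using dfn_conj[of k "P s" "\<lambda>a. \<forall>s\<in>S. P s a"] by simp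
qed

lemma dfn_all_less:
  assumes "\<And>i. i < (m::nat) \<Longrightarrow> dfn k (P i)" shows "dfn k (\<lambda>a. \<forall>i<m. P i a)"
  using dfn_ball[of "{..<m}" k P] assms by (simp add: Ball_def)

lemmas dfn_intros = dfn_conj dfn_disj dfn_imp dfn_neg dfn_ex dfn_all dfn_exs dfn_alls dfn_less dfn_eq
  sel_id sel_const sel_tl sel_take sel_drop sel_append sel_cons sel1_const sel1_hd sel1_nth

end

section \<open>Large sets\<close>

lemma uncountable_mono: "uncountable A \<Longrightarrow> A \<subseteq> B \<Longrightarrow> uncountable B"
  using countable_subset by blast

text \<open>Pigeonhole principle, since a countable union of countable sets is countable. With
  rational data as \<open>I\<close>, it lets one choice of endpoints serve uncountably many
  points.\<close>

lemma uncountable_Collect_ex: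
  assumes "countable I" "uncountable {x. Q x}" "\<And>x. Q x \<Longrightarrow> \<exists>i\<in>I. P i x"
  obtains i where "i \<in> I" "uncountable {x. P i x}"
proof -
  have "{x. Q x} \<subseteq> (\<Union>i\<in>I. {x. P i x})" using assms(3) by blast
  then have "uncountable (\<Union>i\<in>I. {x. P i x})" by (rule uncountable_mono[OF assms(2)])
  then show ?thesis using assms(1) that by blast
qed

primrec large :: "nat \<Rightarrow> (real list \<Rightarrow> bool) \<Rightarrow> bool" where
  "large 0 P \<longleftrightarrow> P []"
| "large (Suc m) P \<longleftrightarrow> uncountable {x. large m (\<lambda>a. P (x # a))}"

lemma large_mono:
  assumes "large m P" "\<And>a. length a = m \<Longrightarrow> P a \<Longrightarrow> Q a"
  shows "large m Q"
  using assms
proof (induction m arbitrary: P Q)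
  case (Suc m)
  have "large m (\<lambda>a. Q (x # a))" if "large m (\<lambda>a. P (x # a))" for x
    using that by (rule Suc.IH) (simp add: Suc.prems(2))
  then have "{x. large m (\<lambda>a. P (x # a))} \<subseteq> {x. large m (\<lambda>a. Q (x # a))}" by blast
  from uncountable_mono[OF _ this] Suc.prems(1) show ?case by simp
qed simp

text \<open>The induction hypothesis picks an index for every good first coordinate, and the
  pigeonhole principle makes it the same index for uncountably many of them.\<close>

lemma large_UN:
  assumes "countable I" "large m (\<lambda>a. \<exists>i\<in>I. P i a)"
  shows "\<exists>i\<in>I. large m (P i)"
  using assms(2)
proof (induction m arbitrary: P)
  case (Suc m)
  have "uncountable {x. large m (\<lambda>a. \<exists>i\<in>I. P i (x # a))}" using Suc.prems by simp
  then obtain i where "i \<in> I" "uncountable {x. large m (\<lambda>a. P i (x # a))}"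
    by (rule uncountable_Collect_ex[OF assms(1)]) (rule Suc.IH)
  then show ?case by auto
qed simp

lemma large_ex: "large m P \<Longrightarrow> \<exists>a. length a = m \<and> P a"
proof (induction m arbitrary: P)
  case (Suc m)
  then obtain x where "large m (\<lambda>a. P (x # a))"
    using uncountable_mono[of "{x. large m (\<lambda>a. P (x # a))}" "{}"] by fastforce
  then obtain a where "length a = m" "P (x # a)" using Suc.IH by blast
  then show ?case by (intro exI[of _ "x # a"]) simp
qed simp

text \<open>The tuple is kept as a list of \<open>k\<close> blocks instead of one long list, so that
  single blocks can be addressed and fixed in \<open>thin_cover\<close>.\<close>

primrec larges :: "nat \<Rightarrow> nat \<Rightarrow> (real list list \<Rightarrow> bool) \<Rightarrow> bool" where
  "larges r 0 P \<longleftrightarrow> P []"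
| "larges r (Suc k) P \<longleftrightarrow> large r (\<lambda>b. larges r k (\<lambda>bs. P (b # bs)))"

lemma larges_mono:
  assumes "larges r k P"
    "\<And>bs. length bs = k \<Longrightarrow> \<forall>b\<in>set bs. length b = r \<Longrightarrow> P bs \<Longrightarrow> Q bs"
  shows "larges r k Q"
  using assms
proof (induction k arbitrary: P Q)
  case (Suc k)
  have "large r (\<lambda>b. larges r k (\<lambda>bs. P (b # bs)))" using Suc.prems(1) by simp
  then have "large r (\<lambda>b. larges r k (\<lambda>bs. Q (b # bs)))"
  proof (rule large_mono)
    fix b :: "real list" assume b: "length b = r" and "larges r k (\<lambda>bs. P (b # bs))"
    then show "larges r k (\<lambda>bs. Q (b # bs))"
      using Suc.IH[of "\<lambda>bs. P (b # bs)" "\<lambda>bs. Q (b # bs)"] Suc.prems(2) by auto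
  qed
  then show ?case by simp
qed simp

lemma larges_UN:
  assumes "countable I" "larges r k (\<lambda>bs. \<exists>i\<in>I. P i bs)"
  shows "\<exists>i\<in>I. larges r k (P i)"
  using assms(2)
proof (induction k arbitrary: P)
  case (Suc k)
  have "large r (\<lambda>b. larges r k (\<lambda>bs. \<exists>i\<in>I. P i (b # bs)))" using Suc.prems by simp
  then have "large r (\<lambda>b. \<exists>i\<in>I. larges r k (\<lambda>bs. P i (b # bs)))"
    by (rule large_mono) (rule Suc.IH)
  from large_UN[OF assms(1) this] show ?case by simp
qed simp

lemma larges_disj:
  assumes "larges r k (\<lambda>bs. P bs \<or> Q bs)"
  shows "larges r k P \<or> larges r k Q"
proof -
  have "larges r k (\<lambda>bs. \<exists>i\<in>(UNIV::bool set). if i then P bs else Q bs)"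
    by (rule larges_mono[OF assms]) (auto simp: UNIV_bool)
  then obtain i where "larges r k (\<lambda>bs. if i then P bs else Q bs)"
    using larges_UN[of UNIV r k "\<lambda>i bs. if i then P bs else Q bs"] by blast
  then show ?thesis by (cases i) auto
qed

lemma larges_ex:
  "larges r k P \<Longrightarrow> \<exists>bs. length bs = k \<and> (\<forall>b\<in>set bs. length b = r) \<and> P bs"
proof (induction k arbitrary: P)
  case (Suc k)
  then obtain b where b: "length b = r" "larges r k (\<lambda>bs. P (b # bs))"
    using large_ex by (metis (no_types, lifting) larges.simps(2))
  then obtain bs where "length bs = k" "\<forall>b\<in>set bs. length b = r" "P (b # bs)"
    using Suc.IH by blast
  then show ?case using b by (intro exI[of _ "b # bs"]) simp
qed simp

lemma larges_add:
  "larges r (k + l) P \<longleftrightarrow> larges r k (\<lambda>as. larges r l (\<lambda>bs. P (as @ bs)))"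
  by (induction k arbitrary: P) auto

lemma larges_all:
  assumes "large r P" shows "larges r k (\<lambda>bs. \<forall>b\<in>set bs. P b)"
proof (induction k)
  case (Suc k)
  have "large r (\<lambda>b. larges r k (\<lambda>bs. \<forall>b'\<in>set (b # bs). P b'))"
  proof (rule large_mono[OF assms])
    fix b assume "P b"
    then show "larges r k (\<lambda>bs. \<forall>b'\<in>set (b # bs). P b')"
      by (intro larges_mono[OF Suc.IH]) auto
  qed
  then show ?case by simp
qed simp

section \<open>One-variable definable sets and boxes\<close>

text \<open>The points of a set of reals that are not interior to it, expressed through the order
  alone so that the notion is first-order.\<close>

definition edge :: "(real \<Rightarrow> bool) \<Rightarrow> real \<Rightarrow> bool" where
  "edge P x \<longleftrightarrow> P x \<and> \<not> (\<exists>p q. p < x \<and> x < q \<and> (\<forall>y. p < y \<and> y < q \<longrightarrow> P y))"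

lemma eventually_nhds_real:
  "eventually P (nhds (x::real)) \<longleftrightarrow> (\<exists>p q. p < x \<and> x < q \<and> (\<forall>y. p < y \<and> y < q \<longrightarrow> P y))"
proof
  assume "eventually P (nhds x)"
  then obtain d where d: "d > 0" "\<And>y. dist y x < d \<Longrightarrow> P y"
    unfolding eventually_nhds_metric by blast
  then show "\<exists>p q. p < x \<and> x < q \<and> (\<forall>y. p < y \<and> y < q \<longrightarrow> P y)"
    by (intro exI[of _ "x - d"] exI[of _ "x + d"]) (auto simp: dist_real_def)
next
  assume "\<exists>p q. p < x \<and> x < q \<and> (\<forall>y. p < y \<and> y < q \<longrightarrow> P y)"
  then obtain p q where "p < x" "x < q" "\<forall>y. p < y \<and> y < q \<longrightarrow> P y" by blast
  then show "eventually P (nhds x)"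
    unfolding eventually_nhds by (intro exI[of _ "{p<..<q}"]) auto
qed

text \<open>Rational endpoints leave only countably many candidates, as the pigeonhole arguments
  require.\<close>

lemma eventually_nhds_real_Rats:
  assumes "eventually P (nhds (x::real))"
  obtains p q where "p \<in> \<rat>" "q \<in> \<rat>" "p < x" "x < q" "\<And>y. p < y \<Longrightarrow> y < q \<Longrightarrow> P y"
proof -
  obtain p q where "p < x" "x < q" and *: "\<forall>y. p < y \<and> y < q \<longrightarrow> P y"
    using assms eventually_nhds_real by blast
  then obtain p' q' where "p' \<in> \<rat>" "p < p'" "p' < x" "q' \<in> \<rat>" "x < q'" "q' < q"
    using Rats_dense_in_real by metis
  then show ?thesis using that * by force
qed

text \<open>Finitely many edges are isolated from each other, so a pair of rationals suffices to
  name one of them.\<close>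

lemma edge_unique_between_Rats:
  assumes "finite {x. edge P x}" "edge P x"
  obtains u v where "u \<in> \<rat>" "v \<in> \<rat>" "u < x" "x < v"
    "\<And>y. u < y \<Longrightarrow> y < v \<Longrightarrow> edge P y \<Longrightarrow> y = x"
proof -
  have "closed ({y. edge P y} - {x})" using assms(1) by (intro finite_imp_closed) auto
  then have "eventually (\<lambda>y. y \<in> - ({y. edge P y} - {x})) (nhds x)"
    by (intro eventually_nhds_in_open open_Compl) auto
  then show ?thesis using that by (elim eventually_nhds_real_Rats) blast
qed

text \<open>An open box given by its two corners. The length conditions make every member of a box
  have the dimension of the corners.\<close>

definition inbox :: "real list \<Rightarrow> real list \<Rightarrow> real list \<Rightarrow> bool" where
  "inbox p q a \<longleftrightarrow> length p = length a \<and> length q = length a \<and> (\<forall>i<length a. p ! i < a ! i \<and> a ! i < q ! i)"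

lemma inbox_Cons [simp]:
  "inbox (x # p) (y # q) (z # a) \<longleftrightarrow> x < z \<and> z < y \<and> inbox p q a"
  unfolding inbox_def by (auto simp: less_Suc_eq_0_disj)

lemma large_inbox:
  assumes "inbox p q b" shows "large (length b) (inbox p q)"
  using assms
proof (induction b arbitrary: p q)
  case Nil
  then show ?case by simp
next
  case (Cons z b)
  then obtain x p' y q' where pq: "p = x # p'" "q = y # q'"
    unfolding inbox_def by (metis length_Suc_conv length_Cons)
  have "{x<..<y} \<subseteq> {z. large (length b) (\<lambda>a. inbox p q (z # a))}"
    using Cons by (auto simp: pq)
  moreover have "x < y" using Cons.prems pq by auto
  ultimately show ?case using uncountable_mono[of "{x<..<y}"] uncountable_open_interval by (auto simp: pq)
qed

lemma inbox_Rats: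
  assumes "inbox p q b"
  obtains p' q' where "p' \<in> lists \<rat>" "q' \<in> lists \<rat>" "inbox p' q' b"
    "\<And>a. inbox p' q' a \<Longrightarrow> inbox p q a"
  using assms
proof (induction b arbitrary: p q thesis)
  case Nil
  show ?case by (rule Nil.prems(1)[of "[]" "[]"]) (use Nil.prems(2) in \<open>auto simp: inbox_def\<close>)
next
  case (Cons z b)
  then obtain x p0 y q0 where pq: "p = x # p0" "q = y # q0"
    unfolding inbox_def by (metis length_Suc_conv length_Cons)
  have "inbox p0 q0 b" "x < z" "z < y" using Cons.prems(2) pq by auto
  obtain p' q' where *: "p' \<in> lists \<rat>" "q' \<in> lists \<rat>" "inbox p' q' b"
    "\<And>a. inbox p' q' a \<Longrightarrow> inbox p0 q0 a"
    using Cons.IH[OF _ \<open>inbox p0 q0 b\<close>] by blast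
  obtain x' y' where xy: "x' \<in> \<rat>" "x < x'" "x' < z" "y' \<in> \<rat>" "z < y'" "y' < y"
    using Rats_dense_in_real \<open>x < z\<close> \<open>z < y\<close> by metis
  show ?case
  proof (rule Cons.prems(1)[of "x' # p'" "y' # q'"])
    fix a assume a: "inbox (x' # p') (y' # q') a"
    then obtain w a' where "a = w # a'" unfolding inbox_def by (cases a) auto
    then show "inbox p q a" using a * xy pq by auto
  qed (use * xy in auto)
qed

context o_minimal_structure
begin

text \<open>A point of an interval component is interior, so every edge is one of the finitely many
  singleton components.\<close>

lemma finite_edge:
  assumes "dfn 1 (\<lambda>e. P (hd e))"
  shows "finite {x. edge P x}"
proof -
  obtain \<phi> c where \<phi>: "wf_fmla M (1 + length c) \<phi>"
    "\<And>a. length a = 1 \<Longrightarrow> P (hd a) = sat M (a @ c) \<phi>"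
    using assms unfolding dfn_def by blast
  have "(\<lambda>x. [x]) ` {x. P x} = {a. length a = 1 \<and> sat M (a @ c) \<phi>}"
  proof (intro set_eqI iffI)
    fix a assume "a \<in> (\<lambda>x. [x]) ` {x. P x}"
    then show "a \<in> {a. length a = 1 \<and> sat M (a @ c) \<phi>}" using \<phi>(2)[of a] by auto
  next
    fix a assume "a \<in> {a. length a = 1 \<and> sat M (a @ c) \<phi>}"
    then show "a \<in> (\<lambda>x. [x]) ` {x. P x}" using \<phi>(2)[of a] by (cases a) auto
  qed
  then have "definable_set M 1 ((\<lambda>x. [x]) ` {x. P x})"
    unfolding definable_set_def using \<phi>(1) by blast
  then obtain \<C> where C: "finite \<C>" "{x. P x} = \<Union>\<C>"
    "\<And>C. C \<in> \<C> \<Longrightarrow> (\<exists>a. C = {a}) \<or> (\<exists>l u :: ereal. C = {x. l < ereal x \<and> ereal x < u})"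
    using o_minimal unfolding o_minimal_def by meson
  have "{x. edge P x} \<subseteq> \<Union>{C\<in>\<C>. \<exists>a. C = {a}}"
  proof
    fix x assume "x \<in> {x. edge P x}"
    then have x: "edge P x" by simp
    then have "P x" unfolding edge_def by blast
    then obtain A where A: "A \<in> \<C>" "x \<in> A" using C(2) by blast
    have "\<exists>a. A = {a}"
    proof (rule ccontr)
      assume "\<not> (\<exists>a. A = {a})"
      then obtain l u :: ereal where lu: "A = {x. l < ereal x \<and> ereal x < u}" using C(3) A by blast
      \<comment> \<open>The ends of the component may be infinite, whereas \<open>edge\<close>
        speaks of real bounds.\<close>
      obtain p q where pq: "l < ereal p" "ereal p < ereal x" "ereal x < ereal q" "ereal q < u"
        using A(2) lu ereal_dense2 by blast
      have "P y" if "p < y" "y < q" for y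
      proof -
        have "l < ereal y" "ereal y < u" using that pq less_trans ereal_less_eq by (metis ereal_less(2) less_ereal.simps(1))+
        then show ?thesis using C(2) A(1) lu by blast
      qed
      then show False using x pq unfolding edge_def by auto
    qed
    then show "x \<in> \<Union>{C\<in>\<C>. \<exists>a. C = {a}}" using A by blast
  qed
  moreover have "finite (\<Union>{C\<in>\<C>. \<exists>a. C = {a}})" using C(1) by auto
  ultimately show ?thesis using finite_subset by blast
qed

text \<open>Only finitely many points are edges, so an infinite definable set has an interior
  point.\<close>

lemma infinite_contains_interval:
  assumes "dfn 1 (\<lambda>e. P (hd e))" "infinite {x. P x}"
  obtains p q where "p \<in> \<rat>" "q \<in> \<rat>" "p < q" "\<And>y. p < y \<Longrightarrow> y < q \<Longrightarrow> P y"
proof -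
  have "\<not> {x. P x} \<subseteq> {x. edge P x}" using finite_edge[OF assms(1)] assms(2) finite_subset by blast
  then obtain x where "eventually P (nhds x)"
    unfolding eventually_nhds_real edge_def by blast
  then show ?thesis using that by (elim eventually_nhds_real_Rats) fastforce
qed

lemma dfn_inbox:
  assumes "sel k f" "sel k g" "sel k h"
    "\<And>a. length a = k \<Longrightarrow> length (f a) = m" "\<And>a. length a = k \<Longrightarrow> length (g a) = m"
    "\<And>a. length a = k \<Longrightarrow> length (h a) = m"
  shows "dfn k (\<lambda>a. inbox (f a) (g a) (h a))"
proof -
  have "dfn k (\<lambda>a. \<forall>i<m. f a ! i < h a ! i \<and> h a ! i < g a ! i)"
    by (intro dfn_all_less dfn_conj dfn_less sel1_nth assms) (auto simp: assms)
  then show ?thesis by (rule dfn_cong) (simp add: inbox_def assms)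
qed

text \<open>By induction every large fibre contains a rational box, and one box serves uncountably
  many first coordinates. The first coordinates that it serves form a definable infinite set, which
  contains an interval; this interval is the missing side.\<close>

lemma large_contains_box:
  assumes "dfn m S" "large m S"
  shows "\<exists>p\<in>lists \<rat>. \<exists>q\<in>lists \<rat>. (\<exists>b. length b = m \<and> inbox p q b) \<and> (\<forall>a. inbox p q a \<longrightarrow> S a)"
  using assms
proof (induction m arbitrary: S)
  case 0
  then show ?case by (intro bexI[of _ "[]"]) (auto simp: inbox_def)
next
  case (Suc m)
  let ?B = "\<lambda>p q S. (\<exists>b. length b = m \<and> inbox p q b) \<and> (\<forall>a. inbox p q a \<longrightarrow> S a)"
  have S: "dfn 1 (\<lambda>e. S (hd e # a))" if "length a = m" for a
    by (rule dfn_subst[OF Suc.prems(1)]) (auto intro!: dfn_intros simp: that)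
  have "countable (lists \<rat> \<times> lists \<rat> :: (real list \<times> real list) set)"
    by (intro countable_SIGMA countable_lists countable_rat)
  moreover have "uncountable {x. large m (\<lambda>a. S (x # a))}" using Suc.prems(2) by simp
  moreover have "\<exists>i\<in>lists \<rat> \<times> lists \<rat>. ?B (fst i) (snd i) (\<lambda>a. S (x # a))"
    if "large m (\<lambda>a. S (x # a))" for x
  proof -
    have "dfn m (\<lambda>a. S (x # a))"
      by (rule dfn_subst[OF Suc.prems(1)]) (auto intro!: dfn_intros)
    from Suc.IH[OF this that] obtain p q where "p \<in> lists \<rat>" "q \<in> lists \<rat>" "?B p q (\<lambda>a. S (x # a))"
      by blast
    then show ?thesis by (intro bexI[of _ "(p, q)"]) auto
  qed
  ultimately obtain i where i: "i \<in> lists \<rat> \<times> lists \<rat>"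
    "uncountable {x. ?B (fst i) (snd i) (\<lambda>a. S (x # a))}"
    by (rule uncountable_Collect_ex)
  define p q where "p = fst i" and "q = snd i"
  have pq: "p \<in> lists \<rat>" "q \<in> lists \<rat>" "uncountable {x. ?B p q (\<lambda>a. S (x # a))}"
    using i unfolding p_def q_def by auto
  then obtain b where b: "length b = m" "inbox p q b"
    using uncountable_mono[OF pq(3), of "{}"] by fastforce
  \<comment> \<open>The guard \<open>length a = m\<close> turns the condition into a quantifier over
    \<open>m\<close>-tuples, which is definable.\<close>
  have "uncountable {x. \<forall>a. length a = m \<longrightarrow> inbox p q a \<longrightarrow> S (x # a)}"
    by (rule uncountable_mono[OF pq(3)]) blast
  then have inf: "infinite {x. \<forall>a. length a = m \<longrightarrow> inbox p q a \<longrightarrow> S (x # a)}"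
    using countable_finite by blast
  have "length p = m" "length q = m" using b by (auto simp: inbox_def)
  then have dfn: "dfn 1 (\<lambda>e. \<forall>a. length a = m \<longrightarrow> inbox p q a \<longrightarrow> S (hd e # a))"
    by (intro dfn_intros dfn_inbox[where m=m] dfn_subst[OF Suc.prems(1)]) simp_all
  obtain u v where uv: "u \<in> \<rat>" "v \<in> \<rat>" "u < v"
    "\<And>y. u < y \<Longrightarrow> y < v \<Longrightarrow> \<forall>a. length a = m \<longrightarrow> inbox p q a \<longrightarrow> S (y # a)"
    using infinite_contains_interval[OF dfn inf] by metis
  obtain w where w: "u < w" "w < v" using uv(3) dense by blast
  show ?case
  proof (rule bexI[of _ "u # p"], rule bexI[of _ "v # q"], intro conjI exI[of _ "w # b"] allI impI)
    fix a assume a: "inbox (u # p) (v # q) a"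
    then obtain y a' where y: "a = y # a'" unfolding inbox_def by (cases a) auto
    then have ya: "inbox p q a'" "u < y" "y < v" using a by simp_all
    then have "length a' = m" using b by (simp add: inbox_def)
    then show "S a" using uv(4)[OF ya(2,3)] ya(1) y by simp
  qed (use b w uv pq in auto)
qed

end

section \<open>Thin families and sets that are not large\<close>

definition ins :: "nat \<Rightarrow> real \<Rightarrow> real list \<Rightarrow> real list" where
  "ins j x a = take j a @ x # drop j a"

text \<open>Once the isolating interval is fixed, the edge is a definable partial function of the
  parameters in \<open>P\<close>.\<close>

definition sole_edge :: "(real \<Rightarrow> bool) \<Rightarrow> real \<Rightarrow> real \<Rightarrow> real \<Rightarrow> bool" where
  "sole_edge P u v x \<longleftrightarrow> u < x \<and> x < v \<and> edge P x \<and> (\<forall>y. u < y \<and> y < v \<and> edge P y \<longrightarrow> y = x)"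

lemma sole_edge_unique: "sole_edge P u v x \<Longrightarrow> sole_edge P u v y \<Longrightarrow> x = y"
  unfolding sole_edge_def by blast

context o_minimal_structure
begin

lemma sel_comp:
  assumes f: "sel k f" and g: "sel l g" "\<And>a. length a = l \<Longrightarrow> length (g a) = k"
  shows "sel l (\<lambda>a. f (g a))"
proof -
  obtain \<sigma> c where f: "\<forall>i\<in>set \<sigma>. i < k + length c"
    "\<And>a. length a = k \<Longrightarrow> f a = map ((!) (a @ c)) \<sigma>" using f unfolding sel_def by blast
  have "sel l (\<lambda>a. map ((!) (g a @ c)) \<sigma>)"
    using f(1)
  proof (induction \<sigma>)
    case Nil
    then show ?case by (simp add: sel_const)
  next
    case (Cons i \<sigma>)
    then have "sel l (\<lambda>a. map ((!) (g a @ c)) \<sigma>)" "sel1 l (\<lambda>a. (g a @ c) ! i)"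
      by (auto intro!: sel1_nth sel_append sel_const g(1) simp: g(2))
    then show ?case by (simp add: sel_cons)
  qed
  then show ?thesis unfolding sel_def using f(2) g(2) by simp
qed

lemma dfn_sole_edge:
  assumes P: "dfn (Suc k) (\<lambda>e. P (tl e) (hd e))" and f: "sel1 k f"
  shows "dfn k (\<lambda>a. sole_edge (P a) u v (f a))"
proof -
  have P': "dfn l (\<lambda>a. P (g a) (h a))"
    if "sel l g" "sel1 l h" "\<And>a. length a = l \<Longrightarrow> length (g a) = k" for l g h
    using dfn_subst[OF P sel_cons[OF that(2,1)]] that(3) by simp
  have f': "sel1 l (\<lambda>a. f (g a))" if "sel l g" "\<And>a. length a = l \<Longrightarrow> length (g a) = k" for l g
    using sel_comp[OF f[unfolded sel1_def] that] unfolding sel1_def .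
  show ?thesis unfolding sole_edge_def edge_def
    by (intro dfn_intros f f' P') simp_all
qed

text \<open>
  Induction on \<open>n\<close>, for a witness \<open>x # c\<close>: if \<open>x\<close> is interior to the fibres of the first half of the
  blocks, it can be moved to a rational. Otherwise \<open>x\<close> is an edge of one of these fibres, hence a
  definable function of \<open>c\<close> once that block is fixed, and the second half of the blocks remains.
\<close>

lemma thin_cover:
  assumes "dfn2 r n R" "\<And>c. length c = n \<Longrightarrow> \<not> large r (\<lambda>b. R b c)"
  shows "\<not> larges r (2 ^ n) (\<lambda>bs. \<exists>c. length c = n \<and> (\<forall>b\<in>set bs. R b c))"
  using assms
proof (induction n arbitrary: R)
  case 0
  then show ?case by auto
next
  case (Suc n)
  note R = Suc.prems(1)
  define k :: nat where "k = 2 ^ n"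
  let ?E = "\<lambda>b c x. edge (\<lambda>y. R b (y # c)) x"
  let ?A = "\<lambda>q bs. \<exists>c. length c = n \<and> (\<forall>b\<in>set (take k bs). R b (q # c))"
  let ?B = "\<lambda>(i, u, v) bs. \<exists>c x. length c = n \<and> sole_edge (\<lambda>y. R (bs ! i) (y # c)) u v x \<and>
    (\<forall>b\<in>set bs. R b (x # c))"
  show ?case
  proof
    assume "larges r (2 ^ Suc n) (\<lambda>bs. \<exists>c. length c = Suc n \<and> (\<forall>b\<in>set bs. R b c))"
    then have "larges r (k + k) (\<lambda>bs. \<exists>c. length c = Suc n \<and> (\<forall>b\<in>set bs. R b c))"
      by (simp add: k_def mult_2)
    then have "larges r (k + k) (\<lambda>bs. (\<exists>q\<in>\<rat>. ?A q bs) \<or> (\<exists>t\<in>{..<k} \<times> \<rat> \<times> \<rat>. ?B t bs))"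
    proof (rule larges_mono)
      fix bs :: "real list list"
      assume len: "length bs = k + k" "\<forall>b\<in>set bs. length b = r"
        and "\<exists>c. length c = Suc n \<and> (\<forall>b\<in>set bs. R b c)"
      then obtain x c where c: "length c = n" "\<forall>b\<in>set bs. R b (x # c)"
        by (metis length_Suc_conv)
      show "(\<exists>q\<in>\<rat>. ?A q bs) \<or> (\<exists>t\<in>{..<k} \<times> \<rat> \<times> \<rat>. ?B t bs)"
      proof (cases "\<forall>b\<in>set (take k bs). \<not> ?E b c x")
        case True
        have "\<forall>b\<in>set (take k bs). eventually (\<lambda>y. R b (y # c)) (nhds x)"
        proof
          fix b assume b: "b \<in> set (take k bs)"
          then have "R b (x # c)" using c in_set_takeD by metis
          then show "eventually (\<lambda>y. R b (y # c)) (nhds x)"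
            using True b unfolding edge_def eventually_nhds_real by blast
        qed
        then have "eventually (\<lambda>y. \<forall>b\<in>set (take k bs). R b (y # c)) (nhds x)"
          by (simp add: eventually_ball_finite)
        then obtain p q where "p < x" "x < q" and pq: "\<And>y. p < y \<Longrightarrow> y < q \<Longrightarrow> \<forall>b\<in>set (take k bs). R b (y # c)"
          by (rule eventually_nhds_real_Rats) blast
        then obtain y where "y \<in> \<rat>" "p < y" "y < q" using Rats_dense_in_real by (meson less_trans)
        then have "\<exists>q\<in>\<rat>. ?A q bs" using pq c(1) by blast
        then show ?thesis by blast
      next
        case False
        then obtain i where i: "i < k" "?E (bs ! i) c x"
          using len(1) by (auto simp: in_set_conv_nth)
        have "length (bs ! i) = r" using len i(1) by simp
        then have "dfn 1 (\<lambda>e. R (bs ! i) (hd e # c))"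
          using c(1) by (intro dfn2_subst[OF R] dfn_intros) simp_all
        from edge_unique_between_Rats[OF finite_edge[OF this] i(2)]
        obtain u v where uv: "u \<in> \<rat>" "v \<in> \<rat>" "u < x" "x < v"
          "\<And>y. u < y \<Longrightarrow> y < v \<Longrightarrow> ?E (bs ! i) c y \<Longrightarrow> y = x" by metis
        then have "sole_edge (\<lambda>y. R (bs ! i) (y # c)) u v x"
          using i(2) unfolding sole_edge_def by blast
        then have "?B (i, u, v) bs" using c by auto
        then show ?thesis using i(1) uv(1,2) by (intro disjI2 bexI[of _ "(i, u, v)"]) auto
      qed
    qed
    from larges_disj[OF this] consider "larges r (k + k) (\<lambda>bs. \<exists>q\<in>\<rat>. ?A q bs)"
      | "larges r (k + k) (\<lambda>bs. \<exists>t\<in>{..<k} \<times> \<rat> \<times> \<rat>. ?B t bs)"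
      by blast
    then show False
    proof cases
      case 1
      from larges_UN[OF countable_rat this]
      obtain q where "larges r (k + k) (?A q)" by blast
      \<comment> \<open>Only the first half of the blocks is constrained; the second half is
        instantiated and dropped.\<close>
      then have "larges r k (\<lambda>as. larges r k (\<lambda>bs. ?A q (as @ bs)))" by (simp add: larges_add)
      then have "larges r k (\<lambda>as. \<exists>c. length c = n \<and> (\<forall>b\<in>set as. R b (q # c)))"
      proof (rule larges_mono)
        fix as :: "real list list"
        assume "length as = k" "larges r k (\<lambda>bs. ?A q (as @ bs))"
        then show "\<exists>c. length c = n \<and> (\<forall>b\<in>set as. R b (q # c))"
          using larges_ex[of r k "\<lambda>bs. ?A q (as @ bs)"] by auto
      qed
      moreover have "dfn2 r n (\<lambda>b c. R b (q # c))"
        unfolding dfn2_def by (intro dfn2_subst[OF R] dfn_intros) simp_all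
      ultimately show False using Suc.IH[of "\<lambda>b c. R b (q # c)"] Suc.prems(2) by (simp add: k_def)
    next
      case 2
      have "countable ({..<k} \<times> (\<rat> :: real set) \<times> (\<rat> :: real set))"
        by (intro countable_SIGMA countable_rat) simp_all
      from larges_UN[OF this 2] obtain i u v where i: "i < k" and *: "larges r (k + k) (?B (i, u, v))"
        by blast
      \<comment> \<open>The blocks up to and including the \<open>i\<close>-th are fixed, the next
        \<open>k\<close> feed the induction hypothesis and the rest are dropped. There are enough
        blocks because \<open>i < k\<close>.\<close>
      have k: "k + k = Suc i + (k + (k - Suc i))" using i by simp
      have "larges r (Suc i) (\<lambda>as. larges r (k + (k - Suc i)) (\<lambda>bs. ?B (i, u, v) (as @ bs)))"
        using * unfolding k by (rule larges_add[THEN iffD1])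
      from larges_ex[OF this] obtain as where as: "length as = Suc i" "\<forall>b\<in>set as. length b = r"
        "larges r (k + (k - Suc i)) (\<lambda>bs. ?B (i, u, v) (as @ bs))" by blast
      define d where "d = as ! i"
      have d: "length d = r" using as unfolding d_def by simp
      \<comment> \<open>With the block \<open>d\<close> fixed, the first coordinate \<open>x\<close>
        is a function of \<open>c\<close>; substituting it lowers the dimension of the point to
        \<open>n\<close>.\<close>
      define R' where "R' b c \<longleftrightarrow> (\<exists>x. sole_edge (\<lambda>y. R d (y # c)) u v x \<and> R b (x # c))" for b c
      have "larges r k (\<lambda>bs. larges r (k - Suc i) (\<lambda>cs. ?B (i, u, v) (as @ (bs @ cs))))"
        using as(3) by (rule larges_add[THEN iffD1])
      then have "larges r k (\<lambda>bs. \<exists>c. length c = n \<and> (\<forall>b\<in>set bs. R' b c))"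
      proof (rule larges_mono)
        fix bs :: "real list list"
        assume "larges r (k - Suc i) (\<lambda>cs. ?B (i, u, v) (as @ (bs @ cs)))"
        from larges_ex[OF this] obtain cs where "?B (i, u, v) (as @ (bs @ cs))" by blast
        moreover have "(as @ (bs @ cs)) ! i = d" using as(1) by (simp add: d_def nth_append)
        ultimately obtain c x where "length c = n" "sole_edge (\<lambda>y. R d (y # c)) u v x"
          "\<forall>b\<in>set (as @ (bs @ cs)). R b (x # c)" by (auto simp del: set_append)
        then show "\<exists>c. length c = n \<and> (\<forall>b\<in>set bs. R' b c)" unfolding R'_def by auto
      qed
      moreover have "dfn2 r n R'"
        unfolding dfn2_def R'_def
        by (intro dfn_intros dfn_sole_edge dfn2_subst[OF R]) (simp_all add: d)
      \<comment> \<open>Thinness survives the substitution, since for given \<open>c\<close> all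
        \<open>b\<close> share the same \<open>x\<close>.\<close>
      moreover have "\<not> large r (\<lambda>b. R' b c)" if "length c = n" for c
      proof
        assume l: "large r (\<lambda>b. R' b c)"
        then obtain x where x: "sole_edge (\<lambda>y. R d (y # c)) u v x"
          using large_ex R'_def by metis
        have "large r (\<lambda>b. R b (x # c))"
          by (rule large_mono[OF l]) (use x in \<open>auto simp: R'_def dest: sole_edge_unique\<close>)
        then show False using Suc.prems(2)[of "x # c"] that by simp
      qed
      ultimately show False using Suc.IH[of R'] by (simp add: k_def)
    qed
  qed
qed

text \<open>A pair \<open>(j, B')\<close> is a graph whose \<open>j\<close>-th coordinate is
  determined by the others. If the first coordinate of a point is an edge of its fibre, the point
  lies on the graph of a sole edge. Otherwise the fibre contains a rational interval around it, and
  the tails over which that whole interval lies in \<open>B\<close> form a set that is not large, to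
  which the induction hypothesis applies.\<close>

lemma not_large_pieces:
  assumes "dfn m B" "\<not> large m B"
  shows "\<exists>F. countable F \<and> (\<forall>(j, B')\<in>F. j < m \<and> dfn m B' \<and>
      (\<forall>a x y. Suc (length a) = m \<longrightarrow> B' (ins j x a) \<longrightarrow> B' (ins j y a) \<longrightarrow> x = y)) \<and>
    (\<forall>a. length a = m \<longrightarrow> B a \<longrightarrow> (\<exists>(j, B')\<in>F. B' a))"
  using assms
proof (induction m arbitrary: B)
  case 0
  then show ?case by (intro exI[of _ "{}"]) auto
next
  case (Suc m)
  let ?A = "\<lambda>p q a. \<forall>t. p < t \<and> t < q \<longrightarrow> B (t # a)"
  note B = Suc.prems(1)
  define good where "good p q F \<longleftrightarrow> countable F \<and> (\<forall>(j, B')\<in>F. j < m \<and> dfn m B' \<and>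
      (\<forall>a x y. Suc (length a) = m \<longrightarrow> B' (ins j x a) \<longrightarrow> B' (ins j y a) \<longrightarrow> x = y)) \<and>
    (\<forall>a. length a = m \<longrightarrow> ?A p q a \<longrightarrow> (\<exists>(j, B')\<in>F. B' a))" for p q F
  have "\<exists>F. good p q F" if "p < q" for p q
  proof -
    have "dfn m (?A p q)" by (intro dfn_intros dfn_subst[OF B]) simp_all
    \<comment> \<open>Otherwise every \<open>t\<close> in the interval, hence uncountably many,
      would have a large fibre in \<open>B\<close>.\<close>
    moreover have "\<not> large m (?A p q)"
    proof
      assume "large m (?A p q)"
      then have "large m (\<lambda>a. B (t # a))" if "p < t" "t < q" for t
        by (rule large_mono) (use that in auto)
      then have "{p<..<q} \<subseteq> {t. large m (\<lambda>a. B (t # a))}" by auto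
      moreover have "uncountable {p<..<q}" using \<open>p < q\<close> by (simp add: uncountable_open_interval)
      ultimately have "uncountable {t. large m (\<lambda>a. B (t # a))}" by (rule uncountable_mono[rotated])
      then show False using Suc.prems(2) by simp
    qed
    ultimately show ?thesis using Suc.IH[of "?A p q"] unfolding good_def by simp
  qed
  then obtain F where F: "\<And>p q. p < q \<Longrightarrow> good p q (F p q)" by metis
  have F1: "countable (F p q)" if "p < q" for p q
    using F[OF that] unfolding good_def by (elim conjE)
  have F2: "j < m \<and> dfn m B' \<and>
      (\<forall>a x y. Suc (length a) = m \<longrightarrow> B' (ins j x a) \<longrightarrow> B' (ins j y a) \<longrightarrow> x = y)"
    if "p < q" "(j, B') \<in> F p q" for p q j B'
  proof -
    have "\<forall>(j, B')\<in>F p q. j < m \<and> dfn m B' \<and>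
      (\<forall>a x y. Suc (length a) = m \<longrightarrow> B' (ins j x a) \<longrightarrow> B' (ins j y a) \<longrightarrow> x = y)"
      using F[OF that(1)] unfolding good_def by (elim conjE)
    from bspec[OF this that(2)] show ?thesis by simp
  qed
  have F3: "\<exists>(j, B')\<in>F p q. B' a" if "p < q" "length a = m" "?A p q a" for p q a
  proof -
    have "\<forall>a. length a = m \<longrightarrow> ?A p q a \<longrightarrow> (\<exists>(j, B')\<in>F p q. B' a)"
      using F[OF that(1)] unfolding good_def by (elim conjE)
    then show ?thesis using that(2,3) by simp
  qed
  \<comment> \<open>\<open>E\<close> gives the graphs of edges, where coordinate 0 is the dependent
    one. \<open>C\<close> multiplies a graph of lower dimension by an interval in front, which moves
    its dependent coordinate one place up.\<close>
  define E :: "real \<times> real \<Rightarrow> nat \<times> (real list \<Rightarrow> bool)"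
    where "E = (\<lambda>(u, v). (0, \<lambda>e. sole_edge (\<lambda>x. B (x # tl e)) u v (hd e)))"
  define C :: "real \<times> real \<Rightarrow> nat \<times> (real list \<Rightarrow> bool) \<Rightarrow> nat \<times> (real list \<Rightarrow> bool)"
    where "C = (\<lambda>(p, q) (j, B'). (Suc j, \<lambda>e. p < hd e \<and> hd e < q \<and> B' (tl e)))"
  define Q :: "(real \<times> real) set" where "Q = {(p, q). p \<in> \<rat> \<and> q \<in> \<rat> \<and> p < q}"
  have Q: "countable Q"
    by (rule countable_subset[of _ "\<rat> \<times> \<rat>"]) (auto simp: Q_def intro: countable_rat)
  define G where "G = E ` (\<rat> \<times> \<rat>) \<union> (\<Union>i\<in>Q. C i ` F (fst i) (snd i))"
  show ?case
  proof (intro exI[of _ G] conjI allI impI)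
    have "countable (C i ` F (fst i) (snd i))" if "i \<in> Q" for i
      using that F1[of "fst i" "snd i"] by (intro countable_image) (auto simp: Q_def)
    then have "countable (\<Union>i\<in>Q. C i ` F (fst i) (snd i))" by (rule countable_UN[OF Q])
    moreover have "countable (E ` (\<rat> \<times> \<rat>))"
      by (intro countable_image countable_SIGMA countable_rat)
    ultimately show "countable G" unfolding G_def by (rule countable_Un[rotated])
    show "\<forall>(j, B')\<in>G. j < Suc m \<and> dfn (Suc m) B' \<and>
      (\<forall>a x y. Suc (length a) = Suc m \<longrightarrow> B' (ins j x a) \<longrightarrow> B' (ins j y a) \<longrightarrow> x = y)"
    proof (rule ballI, rule case_prodI2)
      fix t j B' assume "t \<in> G" "t = (j, B')"
      then have "(j, B') \<in> G" by simp
      then consider u v where "(j, B') = E (u, v)"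
        | p q j' B'' where "p < q" "(j', B'') \<in> F p q" "(j, B') = C (p, q) (j', B'')"
        unfolding G_def Q_def by auto
      then show "j < Suc m \<and> dfn (Suc m) B' \<and>
        (\<forall>a x y. Suc (length a) = Suc m \<longrightarrow> B' (ins j x a) \<longrightarrow> B' (ins j y a) \<longrightarrow> x = y)"
      proof cases
        case 1
        then have j: "j = 0" and B': "B' = (\<lambda>e. sole_edge (\<lambda>x. B (x # tl e)) u v (hd e))"
          by (auto simp: E_def)
        have "dfn (Suc m) B'" unfolding B'
          by (intro dfn_sole_edge dfn_subst[OF B] dfn_intros) simp_all
        then show ?thesis using sole_edge_unique by (auto simp: j B' ins_def)
      next
        case 2
        then have j: "j = Suc j'" and B': "B' = (\<lambda>e. p < hd e \<and> hd e < q \<and> B'' (tl e))"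
          by (auto simp: C_def)
        have *: "j' < m" "dfn m B''"
          "\<And>a x y. Suc (length a) = m \<Longrightarrow> B'' (ins j' x a) \<Longrightarrow> B'' (ins j' y a) \<Longrightarrow> x = y"
          using F2[OF 2(1,2)] by simp_all
        have "dfn (Suc m) B'" unfolding B'
          by (intro dfn_intros dfn_subst[OF *(2)]) simp_all
        moreover have "x = y" if a: "length a = m" "B' (ins j x a)" "B' (ins j y a)" for a x y
        proof -
          obtain t a' where "a = t # a'" using a(1) *(1) by (cases a) auto
          then show ?thesis using a *(3)[of a' x y] by (auto simp: j B' ins_def)
        qed
        ultimately show ?thesis using *(1) j by auto
      qed
    qed
    fix a assume "length a = Suc m" "B a"
    then obtain x b where a: "a = x # b" "length b = m" by (metis length_Suc_conv)
    show "\<exists>(j, B')\<in>G. B' a"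
    proof (cases "edge (\<lambda>x. B (x # b)) x")
      case True
      have "dfn 1 (\<lambda>e. B (hd e # b))" by (intro dfn_intros dfn_subst[OF B]) (simp_all add: a)
      from edge_unique_between_Rats[OF finite_edge[OF this] True]
      obtain u v where uv: "u \<in> \<rat>" "v \<in> \<rat>" "u < x" "x < v"
          "\<And>y. u < y \<Longrightarrow> y < v \<Longrightarrow> edge (\<lambda>x. B (x # b)) y \<Longrightarrow> y = x" by metis
      then have "sole_edge (\<lambda>x. B (x # b)) u v x" using True unfolding sole_edge_def by blast
      then have "case E (u, v) of (j, B') \<Rightarrow> B' a" by (simp add: E_def a)
      moreover have "E (u, v) \<in> G" using uv unfolding G_def by (intro UnI1 imageI) simp
      ultimately show ?thesis by (rule bexI)
    next
      case False
      then have "eventually (\<lambda>x. B (x # b)) (nhds x)"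
        using \<open>B a\<close> unfolding a edge_def eventually_nhds_real by blast
      then obtain p q where pq: "p \<in> \<rat>" "q \<in> \<rat>" "p < x" "x < q" and "\<And>y. p < y \<Longrightarrow> y < q \<Longrightarrow> B (y # b)"
        by (rule eventually_nhds_real_Rats) blast
      then have "\<exists>(j, B')\<in>F p q. B' b" using a(2) by (intro F3) auto
      then obtain j B' where j: "(j, B') \<in> F p q" "B' b" by blast
      have "case C (p, q) (j, B') of (j, B') \<Rightarrow> B' a" using j pq by (simp add: C_def a)
      moreover have "C (p, q) (j, B') \<in> G"
        unfolding G_def Q_def using pq j by (intro UnI2 UN_I[of "(p, q)"]) auto
      ultimately show ?thesis by (rule bexI)
    qed
  qed
qed

end

section \<open>Countable transversals of definable open families\<close>

locale definably_separable_space = o_minimal_structure M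
  for M :: "('f, 'r) real_structure" +
  fixes n :: nat and \<tau> :: "real list topology"
  assumes topspace_subset: "topspace \<tau> \<subseteq> {a. length a = n}"
    and definably_separable: "definably_separable M n \<tau>"
begin

text \<open>The index set is the whole of \<real> to the power \<open>r\<close>: a family over a
  definable subset is extended by the empty set, which is open.\<close>

definition open_family :: "nat \<Rightarrow> (real list \<Rightarrow> real list set) \<Rightarrow> bool" where
  "open_family r U \<longleftrightarrow> dfn2 r n (\<lambda>b c. c \<in> U b) \<and> (\<forall>b. length b = r \<longrightarrow> openin \<tau> (U b))"

text \<open>Applied to a basis, this yields a countable dense set; stated for all open families, it
  can be proved by induction on the number of index coordinates.\<close>

definition transversable :: "nat \<Rightarrow> bool" where
  "transversable r \<longleftrightarrow> (\<forall>U. open_family r U \<longrightarrow>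
     (\<exists>D. countable D \<and> (\<forall>b. length b = r \<longrightarrow> U b \<noteq> {} \<longrightarrow> U b \<inter> D \<noteq> {})))"

lemma length_mem_open: "openin \<tau> V \<Longrightarrow> c \<in> V \<Longrightarrow> length c = n"
  using topspace_subset openin_subset by blast

lemma dfn_mem:
  assumes "open_family r U" "sel k f" "sel k g" "\<And>a. length a = k \<Longrightarrow> length (f a) = r"
    "\<And>a. length a = k \<Longrightarrow> length (g a) = n"
  shows "dfn k (\<lambda>a. g a \<in> U (f a))"
  using dfn2_subst[OF assms(1)[unfolded open_family_def, THEN conjunct1] assms(2-5)] .

lemma dfn_nonempty:
  assumes "open_family r U"
  shows "dfn r (\<lambda>b. U b \<noteq> {})"
proof -
  have "dfn r (\<lambda>b. \<exists>c. length c = n \<and> c \<in> U b)"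
    by (intro dfn_intros dfn_mem[OF assms]) simp_all
  then show ?thesis
  proof (rule dfn_cong)
    fix b :: "real list" assume "length b = r"
    then have "openin \<tau> (U b)" using assms unfolding open_family_def by simp
    then show "(U b \<noteq> {}) = (\<exists>c. length c = n \<and> c \<in> U b)" using length_mem_open by blast
  qed
qed

lemma open_family_restrict:
  assumes "open_family r U" "dfn r B"
  shows "open_family r (\<lambda>b. if B b then U b else {})"
proof -
  have "dfn2 r n (\<lambda>b c. B b \<and> c \<in> U b)"
    unfolding dfn2_def by (intro dfn_intros dfn_subst[OF assms(2)] dfn_mem[OF assms(1)]) simp_all
  then have "dfn2 r n (\<lambda>b c. c \<in> (if B b then U b else {}))"
    unfolding dfn2_def by (rule dfn_cong) simp
  then show ?thesis using assms(1) unfolding open_family_def by simp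
qed

text \<open>The index set is cut into countably many graphs. On each graph one coordinate depends on
  the other \<open>r\<close>, so the family can be reindexed by \<open>r\<close> coordinates and has
  a countable transversal by assumption.\<close>

lemma hitting_set_not_large:
  assumes "transversable r" "open_family (Suc r) U" "dfn (Suc r) B" "\<not> large (Suc r) B"
  shows "\<exists>D. countable D \<and> (\<forall>b. length b = Suc r \<longrightarrow> B b \<longrightarrow> U b \<noteq> {} \<longrightarrow> U b \<inter> D \<noteq> {})"
proof -
  from not_large_pieces[OF assms(3,4)] obtain F where F: "countable F"
    "\<forall>(j, B')\<in>F. j < Suc r \<and> dfn (Suc r) B' \<and>
      (\<forall>a x y. Suc (length a) = Suc r \<longrightarrow> B' (ins j x a) \<longrightarrow> B' (ins j y a) \<longrightarrow> x = y)"
    "\<And>a. length a = Suc r \<Longrightarrow> B a \<Longrightarrow> \<exists>(j, B')\<in>F. B' a"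
    by (elim exE conjE) simp
  define meets where "meets i D \<longleftrightarrow> countable D \<and>
    (\<forall>b. length b = Suc r \<longrightarrow> snd i b \<longrightarrow> U b \<noteq> {} \<longrightarrow> U b \<inter> D \<noteq> {})" for i :: "nat \<times> (real list \<Rightarrow> bool)" and D
  have "\<exists>D. meets i D" if "i \<in> F" for i
  proof -
    obtain j B' where i: "i = (j, B')" by (cases i)
    from bspec[OF F(2) that] have j: "j \<le> r" "dfn (Suc r) B'" and
      uniq: "\<And>a x y. length a = r \<Longrightarrow> B' (ins j x a) \<Longrightarrow> B' (ins j y a) \<Longrightarrow> x = y"
      by (simp_all add: i)
    \<comment> \<open>Taking the union over \<open>x\<close> keeps the family open and definable
      without choosing \<open>x\<close>; by uniqueness it has at most one term.\<close>
    define U' where "U' a = {c. \<exists>x. B' (ins j x a) \<and> c \<in> U (ins j x a)}" for a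
    have "dfn2 r n (\<lambda>a c. \<exists>x. B' (ins j x a) \<and> c \<in> U (ins j x a))"
      unfolding dfn2_def ins_def
      by (intro dfn_intros dfn_subst[OF j(2)] dfn_mem[OF assms(2)]) (use j(1) in simp_all)
    moreover have "openin \<tau> (U' a)" if "length a = r" for a
    proof -
      have "U' a = \<Union>{U (ins j x a) |x. B' (ins j x a)}" unfolding U'_def by blast
      moreover have "length (ins j x a) = Suc r" for x using that j(1) by (simp add: ins_def)
      ultimately show ?thesis using assms(2) unfolding open_family_def by auto
    qed
    ultimately have "open_family r U'" unfolding open_family_def by (simp add: U'_def)
    then obtain D where D: "countable D" "\<And>a. length a = r \<Longrightarrow> U' a \<noteq> {} \<Longrightarrow> U' a \<inter> D \<noteq> {}"
      using assms(1) unfolding transversable_def by blast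
    have "U b \<inter> D \<noteq> {}" if b: "length b = Suc r" "B' b" "U b \<noteq> {}" for b
    proof -
      define a where "a = take j b @ drop (Suc j) b"
      have a: "length a = r" "ins j (b ! j) a = b"
        using j(1) b(1) by (simp_all add: a_def ins_def id_take_nth_drop[symmetric])
      have "U' a = U b"
      proof (intro set_eqI iffI)
        fix c assume "c \<in> U' a"
        then obtain x where "B' (ins j x a)" "c \<in> U (ins j x a)" unfolding U'_def by blast
        then show "c \<in> U b" using uniq[OF a(1), of x "b ! j"] a(2) b(2) by simp
      next
        fix c assume "c \<in> U b"
        then show "c \<in> U' a" unfolding U'_def using a(2) b(2) by (auto intro!: exI[of _ "b ! j"])
      qed
      then show ?thesis using D(2)[OF a(1)] b(3) by simp
    qed
    then have "meets i D" using D(1) unfolding meets_def i by simp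
    then show ?thesis by (rule exI)
  qed
  then obtain D where "\<And>i. i \<in> F \<Longrightarrow> meets i (D i)" by metis
  then have D: "\<And>i. i \<in> F \<Longrightarrow> countable (D i)"
    "\<And>i b. i \<in> F \<Longrightarrow> length b = Suc r \<Longrightarrow> snd i b \<Longrightarrow> U b \<noteq> {} \<Longrightarrow> U b \<inter> D i \<noteq> {}"
    unfolding meets_def by simp_all
  show ?thesis
  proof (intro exI conjI allI impI)
    show "countable (\<Union>i\<in>F. D i)" by (rule countable_UN[OF F(1) D(1)])
    fix b assume b: "length b = Suc r" "B b" "U b \<noteq> {}"
    obtain i where "i \<in> F" "snd i b" using F(3)[OF b(1,2)] by (auto simp: case_prod_beta)
    then show "U b \<inter> (\<Union>i\<in>F. D i) \<noteq> {}" using D(2)[of i b] b by auto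
  qed
qed

text \<open>The bad family is the restriction to those \<open>b\<close> around which no box of parameters has a common
  point; off this set, one point for each rational box suffices.\<close>

lemma not_transversable_Suc:
  assumes "transversable r" "\<not> transversable (Suc r)"
  obtains U where "open_family (Suc r) U" "large (Suc r) (\<lambda>b. U b \<noteq> {})"
    "\<And>c. \<not> large (Suc r) (\<lambda>b. c \<in> U b)"
proof -
  define m where "m = Suc r"
  obtain U where U: "open_family m U" and
    "\<nexists>D. countable D \<and> (\<forall>b. length b = m \<longrightarrow> U b \<noteq> {} \<longrightarrow> U b \<inter> D \<noteq> {})"
    using assms(2) unfolding transversable_def m_def[symmetric] not_all not_imp
    by (elim exE conjE) (rule that)
  then have no: "\<exists>b. length b = m \<and> U b \<noteq> {} \<and> U b \<inter> D = {}" if "countable D" for D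
    using that by simp
  define T where "T b \<longleftrightarrow> \<not> (\<exists>p. length p = m \<and> (\<exists>q. length q = m \<and> (\<exists>c. length c = n \<and> inbox p q b \<and>
    (\<forall>b'. length b' = m \<longrightarrow> inbox p q b' \<longrightarrow> c \<in> U b'))))" for b
  have T: "dfn m T"
    unfolding T_def
    by (intro dfn_intros dfn_mem[OF U] dfn_inbox[where m=m]) simp_all
  define V where "V b = (if T b then U b else {})" for b
  have V: "open_family m V" unfolding V_def by (rule open_family_restrict[OF U T])
  show ?thesis
  proof (rule that)
    show "open_family (Suc r) V" using V by (simp add: m_def)
    show "large (Suc r) (\<lambda>b. V b \<noteq> {})"
    proof (rule ccontr)
      assume small: "\<not> large (Suc r) (\<lambda>b. V b \<noteq> {})"
      \<comment> \<open>The index predicate inserted here is nonemptiness of \<open>V b\<close>, so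
        this condition occurs twice.\<close>
      obtain D where D: "countable D"
        "\<forall>b. length b = Suc r \<longrightarrow> V b \<noteq> {} \<longrightarrow> V b \<noteq> {} \<longrightarrow> V b \<inter> D \<noteq> {}"
        using hitting_set_not_large[OF assms(1) V[unfolded m_def] dfn_nonempty[OF V[unfolded m_def]] small]
        by (elim exE conjE)
      define pt where "pt = (\<lambda>(p, q). SOME c. \<forall>b. length b = m \<longrightarrow> inbox p q b \<longrightarrow> c \<in> U b)"
      have "countable (D \<union> pt ` (lists \<rat> \<times> lists \<rat>))"
        using D(1) by (intro countable_Un countable_image countable_SIGMA countable_lists countable_rat)
      from no[OF this] obtain b where b: "length b = m" "U b \<noteq> {}" "U b \<inter> D = {}"
        "U b \<inter> pt ` (lists \<rat> \<times> lists \<rat>) = {}" by blast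
      have "\<not> T b"
      proof
        assume "T b"
        then have "V b = U b" by (simp add: V_def)
        then show False using D(2)[rule_format, of b] b(1-3) unfolding m_def by simp
      qed
      then obtain p q c where pq: "inbox p q b" "\<forall>b'. length b' = m \<longrightarrow> inbox p q b' \<longrightarrow> c \<in> U b'"
        unfolding T_def not_not by (elim exE conjE)
      from pq(1) obtain p' q' where pq': "p' \<in> lists \<rat>" "q' \<in> lists \<rat>" "inbox p' q' b"
        "\<And>a. inbox p' q' a \<Longrightarrow> inbox p q a" by (rule inbox_Rats) blast
      have "\<forall>b. length b = m \<longrightarrow> inbox p' q' b \<longrightarrow> c \<in> U b" using pq(2) pq'(4) by blast
      then have "\<forall>b. length b = m \<longrightarrow> inbox p' q' b \<longrightarrow> pt (p', q') \<in> U b"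
        unfolding pt_def prod.case by (rule someI)
      then have "pt (p', q') \<in> U b" using b(1) pq'(3) by blast
      then show False using b(4) pq'(1,2) by blast
    qed
    fix c
    show "\<not> large (Suc r) (\<lambda>b. c \<in> V b)"
    proof
      assume l: "large (Suc r) (\<lambda>b. c \<in> V b)"
      then obtain b0 where "length b0 = m" "c \<in> V b0" using large_ex[OF l] unfolding m_def by blast
      then have c: "length c = n" using V length_mem_open unfolding open_family_def by blast
      have "dfn m (\<lambda>b. c \<in> V b)" using c by (intro dfn_mem[OF V] dfn_intros) simp_all
      \<comment> \<open>If \<open>c\<close> belonged to a large set of members, it would be common
        to a whole box of them, which \<open>T\<close> excludes for every index in that box.\<close>
      from large_contains_box[OF this l[folded m_def]]
      obtain p q b where b: "length b = m" "inbox p q b" "\<And>a. inbox p q a \<Longrightarrow> c \<in> V a" by blast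
      have "c \<in> V b" using b by blast
      then have "T b" by (auto simp: V_def split: if_splits)
      have "c \<in> U a" if "inbox p q a" for a using b(3)[OF that] by (auto simp: V_def split: if_splits)
      moreover have "length p = m" "length q = m" using b(1,2) by (auto simp: inbox_def)
      ultimately show False using \<open>T b\<close> b(2) c unfolding T_def by blast
    qed
  qed
qed

lemma transversable_0: "transversable 0"
  unfolding transversable_def
proof (intro allI impI)
  fix U :: "real list \<Rightarrow> real list set"
  show "\<exists>D. countable D \<and> (\<forall>b. length b = 0 \<longrightarrow> U b \<noteq> {} \<longrightarrow> U b \<inter> D \<noteq> {})"
  proof (cases "U [] = {}")
    case True
    then show ?thesis by (intro exI[of _ "{}"]) simp
  next
    case False
    then obtain c where "c \<in> U []" by blast
    then show ?thesis by (intro exI[of _ "{c}"]) simp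
  qed
qed

end

section \<open>Definable families as definable relations between index and point\<close>

context o_minimal_structure
begin

lemma definable_set_of_dfn:
  assumes "dfn m B" shows "definable_set M m {b. length b = m \<and> B b}"
proof -
  obtain \<phi> c where "wf_fmla M (m + length c) \<phi>" "\<And>a. length a = m \<Longrightarrow> B a = sat M (a @ c) \<phi>"
    using assms unfolding dfn_def by blast
  then show ?thesis unfolding definable_set_def by (intro exI[of _ \<phi>] exI[of _ c]) auto
qed

lemma dfn_of_definable_set:
  assumes "definable_set M m B" shows "dfn m (\<lambda>b. b \<in> B)"
proof -
  obtain \<phi> c where "wf_fmla M (m + length c) \<phi>" "B = {a. length a = m \<and> sat M (a @ c) \<phi>}"
    using assms unfolding definable_set_def by blast
  then show ?thesis unfolding dfn_def by (intro exI[of _ \<phi>] exI[of _ c]) auto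
qed

text \<open>The formula of a definable family reads the point before the index, while
  \<open>dfn2 m n\<close> reads the index first, so the two blocks of variables are
  exchanged.\<close>

lemma definable_family_of_dfn:
  assumes "dfn m B" "dfn2 m n (\<lambda>b c. c \<in> U b)"
    "\<And>b c. length b = m \<Longrightarrow> B b \<Longrightarrow> c \<in> U b \<Longrightarrow> length c = n"
  shows "definable_family M n (U ` {b. length b = m \<and> B b})"
proof -
  have "dfn (n + m) (\<lambda>e. take n e \<in> U (drop n e))"
    by (intro dfn2_subst[OF assms(2)] dfn_intros) simp_all
  then obtain \<phi> c where \<phi>: "wf_fmla M (n + m + length c) \<phi>"
    "\<And>e. length e = n + m \<Longrightarrow> (take n e \<in> U (drop n e)) = sat M (e @ c) \<phi>"
    unfolding dfn_def by blast
  have "U b = {a. length a = n \<and> sat M (a @ b @ c) \<phi>}" if "length b = m" "B b" for b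
  proof (intro set_eqI)
    fix a
    show "a \<in> U b \<longleftrightarrow> a \<in> {a. length a = n \<and> sat M (a @ b @ c) \<phi>}"
      using \<phi>(2)[of "a @ b"] assms(3)[OF that, of a] that(1) by auto
  qed
  then have "U ` {b. length b = m \<and> B b} =
    (\<lambda>b. {a. length a = n \<and> sat M (a @ b @ c) \<phi>}) ` {b. length b = m \<and> B b}"
    by (intro image_cong) auto
  then show ?thesis unfolding definable_family_def
    using definable_set_of_dfn[OF assms(1)] \<phi>(1) by blast
qed

lemma definable_familyE:
  assumes "definable_family M n \<A>"
  obtains m B U where "dfn m B" "dfn2 m n (\<lambda>b c. c \<in> U b)" "\<A> = U ` {b. length b = m \<and> B b}"
proof -
  obtain m B \<phi> c where *: "definable_set M m B" "wf_fmla M (n + m + length c) \<phi>"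
    "\<A> = (\<lambda>b. {a. length a = n \<and> sat M (a @ b @ c) \<phi>}) ` B"
    using assms unfolding definable_family_def by blast
  have B: "B = {b. length b = m \<and> b \<in> B}" using *(1) unfolding definable_set_def by auto
  have "dfn (n + m) (\<lambda>e. sat M (e @ c) \<phi>)"
    unfolding dfn_def using *(2) by blast
  then have "dfn (m + n) (\<lambda>e. sat M ((drop m e @ take m e) @ c) \<phi>)"
    by (rule dfn_subst) (auto intro!: dfn_intros)
  then have "dfn2 m n (\<lambda>b a. a \<in> {a. length a = n \<and> sat M (a @ b @ c) \<phi>})"
    unfolding dfn2_def by (rule dfn_cong) simp
  from that[OF dfn_of_definable_set[OF *(1)] this] show ?thesis
    using *(3) unfolding B[symmetric] by blast
qed

end

lemma large_1: "large 1 P \<longleftrightarrow> uncountable {x. P [x]}"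
  by (simp add: One_nat_def)

section \<open>Common points of many members, and the induction on the number of parameters\<close>

context definably_separable_space
begin

text \<open>Otherwise uncountably many \<open>x\<close> have a nonempty member meeting only
  countably, hence finitely, many others. Each such \<open>x\<close> then has a rational
  \<open>q\<close> above it such that no \<open>y\<close> between \<open>x\<close> and
  \<open>q\<close> is linked to \<open>x\<close>. One \<open>q\<close> serves uncountably many
  \<open>x\<close>, so it serves an interval of them, and the members over that interval are an
  infinite definable disjoint family.\<close>

lemma large_linked:
  assumes U: "open_family 1 U" and l: "large 1 (\<lambda>b. U b \<noteq> {})"
  shows "large 1 (\<lambda>b. large 1 (\<lambda>b'. U b \<inter> U b' \<noteq> {}))"
proof (rule ccontr)
  define linked where "linked x y \<longleftrightarrow> U [x] \<inter> U [y] \<noteq> {}" for x y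
  define H where "H = {x. uncountable {y. linked x y}}"
  assume "\<not> large 1 (\<lambda>b. large 1 (\<lambda>b'. U b \<inter> U b' \<noteq> {}))"
  then have H: "countable H" by (simp add: large_1 H_def linked_def)
  have len: "length c = n" if "c \<in> U [x]" for c x
    using U length_mem_open[of "U [x]"] that unfolding open_family_def by simp
  have linked_iff: "linked x y \<longleftrightarrow> (\<exists>c. length c = n \<and> c \<in> U [x] \<and> c \<in> U [y])" for x y
    using len unfolding linked_def by blast
  have linked: "dfn k (\<lambda>a. linked (f a) (g a))" if "sel1 k f" "sel1 k g" for k f g
  proof -
    have 1: "sel k (\<lambda>a. [f a])" "sel k (\<lambda>a. [g a])" using that by (simp_all add: sel1_def)
    have "sel (n + k) (\<lambda>a. [f (drop n a)])" "sel (n + k) (\<lambda>a. [g (drop n a)])"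
      by (rule sel_comp[OF 1(1)] sel_comp[OF 1(2)], intro dfn_intros, simp)+
    then show ?thesis
      unfolding linked_iff by (intro dfn_exs dfn_conj dfn_mem[OF U] sel_take sel_id) simp_all
  qed
  have "uncountable {x. U [x] \<noteq> {}}" using l unfolding large_1 .
  then have "uncountable ({x. U [x] \<noteq> {}} - H)" by (rule uncountable_minus_countable[OF _ H])
  then have G: "uncountable {x. U [x] \<noteq> {} \<and> x \<notin> H}"
    by (rule uncountable_mono) blast
  have sep: "\<exists>q\<in>\<rat>. U [x] \<noteq> {} \<and> x < q \<and> (\<forall>y. x < y \<and> y < q \<longrightarrow> \<not> linked x y)"
    if x: "U [x] \<noteq> {} \<and> x \<notin> H" for x
  proof -
    have d: "dfn 1 (\<lambda>e. linked x (hd e))" by (intro linked dfn_intros) simp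
    have "finite {y. linked x y}"
    proof (rule ccontr)
      assume "infinite {y. linked x y}"
      from infinite_contains_interval[OF d this]
      obtain p q where "p < q" "\<And>y. p < y \<Longrightarrow> y < q \<Longrightarrow> linked x y" by metis
      then have "{p<..<q} \<subseteq> {y. linked x y}" "uncountable {p<..<q}"
        by (auto simp: uncountable_open_interval)
      then have "x \<in> H" using uncountable_mono unfolding H_def by blast
      then show False using x by blast
    qed
    then have "closed ({y. linked x y} - {x})" by (intro finite_imp_closed) simp
    then have "eventually (\<lambda>y. y \<in> - ({y. linked x y} - {x})) (nhds x)"
      by (intro eventually_nhds_in_open open_Compl) simp_all
    then obtain p q where pq: "p \<in> \<rat>" "q \<in> \<rat>" "p < x" "x < q"
      "\<And>y. p < y \<Longrightarrow> y < q \<Longrightarrow> y \<in> - ({y. linked x y} - {x})"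
      by (rule eventually_nhds_real_Rats) blast
    have "\<not> linked x y" if "x < y" "y < q" for y using pq(5)[of y] pq(3) that by auto
    then show ?thesis using x pq(2,4) by blast
  qed
  obtain q where q: "uncountable {x. U [x] \<noteq> {} \<and> x < q \<and> (\<forall>y. x < y \<and> y < q \<longrightarrow> \<not> linked x y)}"
    by (rule uncountable_Collect_ex[OF countable_rat G sep]) simp_all
  then have inf: "infinite {x. U [x] \<noteq> {} \<and> x < q \<and> (\<forall>y. x < y \<and> y < q \<longrightarrow> \<not> linked x y)}"
    using countable_finite by blast
  have "dfn 1 (\<lambda>e. U [hd e] \<noteq> {} \<and> hd e < q \<and> (\<forall>y. hd e < y \<and> y < q \<longrightarrow> \<not> linked (hd e) y))"
    by (intro dfn_intros linked dfn_subst[OF dfn_nonempty[OF U]]) simp_all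
  from infinite_contains_interval[OF this inf] obtain u v where uv: "u < v"
    and Z: "\<And>x. u < x \<Longrightarrow> x < v \<Longrightarrow> U [x] \<noteq> {} \<and> x < q \<and> (\<forall>y. x < y \<and> y < q \<longrightarrow> \<not> linked x y)"
    by metis
  \<comment> \<open>The smaller point is unlinked to everything between it and \<open>q\<close>, and
    the larger point lies there.\<close>
  have disj: "U [x] \<inter> U [y] = {}" if "u < x" "x < v" "u < y" "y < v" "x \<noteq> y" for x y
  proof -
    have "\<not> linked (min x y) (max x y)"
      using Z[of "min x y"] Z[of "max x y"] that by (auto simp: min_def max_def split: if_splits)
    then show ?thesis by (auto simp: linked_def min_def max_def split: if_splits)
  qed
  define \<A> where "\<A> = U ` {b. length b = 1 \<and> u < hd b \<and> hd b < v}"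
  have A: "\<A> = (\<lambda>x. U [x]) ` {u<..<v}"
  proof -
    have "{b. length b = 1 \<and> u < hd b \<and> hd b < v} = (\<lambda>x. [x]) ` {u<..<v}"
      by (auto simp: length_Suc_conv)
    then show ?thesis by (simp add: \<A>_def image_image)
  qed
  have "definable_family M n \<A>"
    unfolding \<A>_def
  proof (rule definable_family_of_dfn)
    show "dfn 1 (\<lambda>b. u < hd b \<and> hd b < v)" by (intro dfn_intros) simp_all
    show "dfn2 1 n (\<lambda>b c. c \<in> U b)" using U unfolding open_family_def by blast
    fix b c :: "real list" assume "length b = 1" "c \<in> U b"
    then show "length c = n" using U length_mem_open unfolding open_family_def by blast
  qed
  moreover have "infinite \<A>"
  proof -
    have "inj_on (\<lambda>x. U [x]) {u<..<v}"
    proof (rule inj_onI, rule ccontr)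
      fix x y assume "x \<in> {u<..<v}" "y \<in> {u<..<v}" "U [x] = U [y]" "x \<noteq> y"
      then show False using disj[of x y] Z[of x] by auto
    qed
    then show ?thesis using uv unfolding A by (simp add: finite_image_iff)
  qed
  moreover have "pairwise disjnt \<A>"
    unfolding A pairwise_def disjnt_def using disj by fastforce
  moreover have "\<forall>A\<in>\<A>. openin \<tau> A"
    using U unfolding A open_family_def by simp
  ultimately show False using definably_separable unfolding definably_separable_def by blast
qed

text \<open>After fixing a \<open>b\<close> whose member meets a large set of others, the induction
  hypothesis is applied to the traces \<open>U b \<inter> U b'\<close>. Their tuple has
  \<open>Suc k\<close> entries, so it is nonempty and the common point lies in \<open>U b\<close>
  too.\<close>

lemma larges_linked:
  assumes "open_family 1 U" "large 1 (\<lambda>b. U b \<noteq> {})"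
  shows "larges 1 (Suc k) (\<lambda>bs. \<exists>c. \<forall>b\<in>set bs. c \<in> U b)"
  using assms
proof (induction k arbitrary: U)
  case 0
  have "large 1 (\<lambda>b. \<exists>c. c \<in> U b)" by (rule large_mono[OF 0(2)]) blast
  then show ?case by simp
next
  case (Suc k)
  have "large 1 (\<lambda>b. larges 1 (Suc k) (\<lambda>bs. \<exists>c. \<forall>b'\<in>set (b # bs). c \<in> U b'))"
  proof (rule large_mono[OF large_linked[OF Suc.prems]])
    fix b :: "real list"
    assume b: "length b = 1" and l: "large 1 (\<lambda>b'. U b \<inter> U b' \<noteq> {})"
    have "openin \<tau> (U b)" using Suc.prems(1) b unfolding open_family_def by blast
    then have "open_family 1 (\<lambda>b'. U b \<inter> U b')"
      using Suc.prems(1) b unfolding open_family_def dfn2_def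
      by (auto intro!: dfn_intros dfn_mem[OF Suc.prems(1)] openin_Int)
    from Suc.IH[OF this l] show "larges 1 (Suc k) (\<lambda>bs. \<exists>c. \<forall>b'\<in>set (b # bs). c \<in> U b')"
      by (rule larges_mono) (auto simp: neq_Nil_conv length_Suc_conv)
  qed
  then show ?case by (simp only: larges.simps)
qed

text \<open>A bad family would have common points for a large set of \<open>2 ^ n\<close>-tuples
  while each point lies in few members, which \<open>thin_cover\<close> rules out.\<close>

lemma transversable_1: "transversable 1"
proof (rule ccontr)
  assume "\<not> transversable 1"
  then have "\<not> transversable (Suc 0)" by simp
  from not_transversable_Suc[OF transversable_0 this] obtain U where
    U: "open_family 1 U" "large 1 (\<lambda>b. U b \<noteq> {})" "\<And>c. \<not> large 1 (\<lambda>b. c \<in> U b)"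
    unfolding One_nat_def[symmetric] by blast
  obtain k where k: "2 ^ n = Suc k" using not0_implies_Suc[of "2 ^ n"] by auto
  have "larges 1 (2 ^ n) (\<lambda>bs. \<exists>c. length c = n \<and> (\<forall>b\<in>set bs. c \<in> U b))"
    unfolding k
  proof (rule larges_mono[OF larges_linked[OF U(1,2)]])
    fix bs :: "real list list"
    assume bs: "length bs = Suc k" "\<forall>b\<in>set bs. length b = 1" "\<exists>c. \<forall>b\<in>set bs. c \<in> U b"
    then obtain c where c: "\<forall>b\<in>set bs. c \<in> U b" by blast
    have "hd bs \<in> set bs" using bs(1) by (cases bs) auto
    then have "openin \<tau> (U (hd bs))" "c \<in> U (hd bs)"
      using U(1) bs(2) c unfolding open_family_def by auto
    then show "\<exists>c. length c = n \<and> (\<forall>b\<in>set bs. c \<in> U b)" using length_mem_open c by blast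
  qed
  moreover have "dfn2 1 n (\<lambda>b c. c \<in> U b)" using U(1) unfolding open_family_def by blast
  ultimately show False using thin_cover[of 1 n "\<lambda>b c. c \<in> U b"] U(3) by blast
qed

text \<open>In a bad family, the case \<open>r\<close> makes one point common to a box of tails
  \<open>a\<close> over each of uncountably many \<open>t\<close>, and one rational box serves
  uncountably many \<open>t\<close>. For finitely many tails in that box, the case 1 then yields one
  point that works for a whole interval of \<open>t\<close>. After fixing a rational interval for a
  large set of tuples, \<open>thin_cover\<close> in \<open>r\<close> parameters gives the
  contradiction.\<close>

lemma transversable_Suc:
  assumes "transversable r" shows "transversable (Suc r)"
proof (rule ccontr)
  assume "\<not> transversable (Suc r)"
  from not_transversable_Suc[OF assms this] obtain U where
    U: "open_family (Suc r) U" "large (Suc r) (\<lambda>b. U b \<noteq> {})" "\<And>c. \<not> large (Suc r) (\<lambda>b. c \<in> U b)"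
    by blast
  have len: "length c = n" if "c \<in> U b" "length b = Suc r" for b c
    using U(1) length_mem_open[of "U b"] that unfolding open_family_def by simp
  define Q where "Q = (lists \<rat> \<times> lists \<rat> :: (real list \<times> real list) set)"
  \<comment> \<open>The point \<open>c\<close> may vary with \<open>t\<close>, but the box
    \<open>i\<close> is rational and can be held fixed for uncountably many
    \<open>t\<close>.\<close>
  define bx where "bx i t \<longleftrightarrow> (\<exists>b. length b = r \<and> inbox (fst i) (snd i) b) \<and>
    (\<exists>c. \<forall>a. inbox (fst i) (snd i) a \<longrightarrow> c \<in> U (t # a))" for i t
  have Q: "countable Q" unfolding Q_def
    by (intro countable_SIGMA countable_lists countable_rat)
  have unc: "uncountable {t. large r (\<lambda>a. U (t # a) \<noteq> {})}" using U(2) by simp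
  have ex: "\<exists>i\<in>Q. bx i t" if l: "large r (\<lambda>a. U (t # a) \<noteq> {})" for t
  proof -
    have "open_family r (\<lambda>a. U (t # a))"
      unfolding open_family_def dfn2_def
      by (intro conjI dfn_mem[OF U(1)] dfn_intros) (use U(1) in \<open>simp_all add: open_family_def\<close>)
    then obtain D where D: "countable D" "\<And>a. length a = r \<Longrightarrow> U (t # a) \<noteq> {} \<Longrightarrow> U (t # a) \<inter> D \<noteq> {}"
      using assms unfolding transversable_def by blast
    have "large r (\<lambda>a. \<exists>c\<in>D. c \<in> U (t # a))"
      by (rule large_mono[OF l]) (use D(2) in blast)
    from large_UN[OF D(1) this] obtain c where c: "large r (\<lambda>a. c \<in> U (t # a))" by blast
    then obtain a where "length a = r" "c \<in> U (t # a)" using large_ex[OF c] by blast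
    then have "length c = n" using len by simp
    then have "dfn r (\<lambda>a. c \<in> U (t # a))"
      by (intro dfn_mem[OF U(1)] dfn_intros) simp_all
    from large_contains_box[OF this c] obtain p q where pq: "p \<in> lists \<rat>" "q \<in> lists \<rat>"
      "\<exists>b. length b = r \<and> inbox p q b" "\<forall>a. inbox p q a \<longrightarrow> c \<in> U (t # a)" by blast
    then have "bx (p, q) t" "(p, q) \<in> Q" unfolding bx_def Q_def by auto
    then show ?thesis by blast
  qed
  obtain i where i: "i \<in> Q" "uncountable {t. bx i t}"
    by (rule uncountable_Collect_ex[OF Q unc ex])
  define p q where "p = fst i" and "q = snd i"
  obtain t where "bx i t" using uncountable_mono[OF i(2), of "{}"] by fastforce
  then obtain b0 where b0: "length b0 = r" "inbox p q b0" unfolding bx_def p_def q_def by blast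
  \<comment> \<open>Here one point \<open>c\<close> must serve all tails in \<open>bs\<close> and
    all \<open>t\<close> in the interval \<open>uv\<close> at once.\<close>
  define W where "W uv bs \<longleftrightarrow> fst uv < snd uv \<and> (\<exists>c. length c = n \<and>
    (\<forall>b\<in>set bs. \<forall>t. fst uv < t \<and> t < snd uv \<longrightarrow> c \<in> U (t # b)))" for uv :: "real \<times> real" and bs
  have W: "\<exists>uv\<in>\<rat> \<times> \<rat>. W uv bs"
    if bs: "bs \<noteq> []" "\<forall>b\<in>set bs. length b = r" "\<forall>b\<in>set bs. inbox p q b" for bs
  proof -
    define V where "V a = (\<Inter>b\<in>set bs. U (a @ b))" for a
    have "dfn2 1 n (\<lambda>a c. \<forall>b\<in>set bs. c \<in> U (a @ b))"
      unfolding dfn2_def using bs(2)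
      by (intro dfn_ball dfn_mem[OF U(1)] dfn_intros) simp_all
    moreover have "openin \<tau> (V a)" if "length a = 1" for a
      unfolding V_def using U(1) bs(1,2) that
      by (intro openin_Inter) (auto simp: open_family_def)
    ultimately have V: "open_family 1 V" unfolding open_family_def by (simp add: V_def)
    have "{t. bx i t} \<subseteq> {t. V [t] \<noteq> {}}"
    proof
      fix t assume "t \<in> {t. bx i t}"
      then obtain c where "\<forall>a. inbox p q a \<longrightarrow> c \<in> U (t # a)"
        unfolding bx_def p_def q_def by blast
      then have "c \<in> V [t]" using bs(3) by (simp add: V_def)
      then show "t \<in> {t. V [t] \<noteq> {}}" by blast
    qed
    from uncountable_mono[OF i(2) this] have l: "large 1 (\<lambda>a. V a \<noteq> {})" unfolding large_1 .
    obtain D where D: "countable D" "\<And>a. length a = 1 \<Longrightarrow> V a \<noteq> {} \<Longrightarrow> V a \<inter> D \<noteq> {}"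
      using transversable_1 V unfolding transversable_def by blast
    have "large 1 (\<lambda>a. \<exists>c\<in>D. c \<in> V a)"
      by (rule large_mono[OF l]) (use D(2) in blast)
    from large_UN[OF D(1) this] obtain c where c: "large 1 (\<lambda>a. c \<in> V a)" by blast
    then obtain a where "length a = 1" "c \<in> V a" using large_ex[OF c] by blast
    then have lc: "length c = n" using V length_mem_open unfolding open_family_def by blast
    have "infinite {t. c \<in> V [t]}" using c countable_finite unfolding large_1 by blast
    moreover have "dfn 1 (\<lambda>e. c \<in> V [hd e])"
      using lc by (intro dfn_mem[OF V] dfn_intros) simp_all
    ultimately obtain u v where uv: "u \<in> \<rat>" "v \<in> \<rat>" "u < v" "\<And>y. u < y \<Longrightarrow> y < v \<Longrightarrow> c \<in> V [y]"
      using infinite_contains_interval[of "\<lambda>t. c \<in> V [t]"] by metis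
    have "W (u, v) bs" unfolding W_def
    proof (intro conjI exI[of _ c] ballI allI impI)
      fix b t assume "b \<in> set bs" "fst (u, v) < t \<and> t < snd (u, v)"
      then show "c \<in> U (t # b)" using uv(4)[of t] by (simp add: V_def)
    qed (use lc uv in simp_all)
    then show ?thesis using uv(1,2) by (intro bexI[of _ "(u, v)"]) auto
  qed
  have "large r (inbox p q)" using large_inbox[OF b0(2)] b0(1) by simp
  from larges_all[OF this, of "2 ^ n"] have ex_W: "larges r (2 ^ n) (\<lambda>bs. \<exists>uv\<in>\<rat> \<times> \<rat>. W uv bs)"
  proof (rule larges_mono)
    fix bs :: "real list list"
    assume bs: "length bs = 2 ^ n" "\<forall>b\<in>set bs. length b = r" "\<forall>b\<in>set bs. inbox p q b"
    \<comment> \<open>An intersection over an empty list would be the whole type, which need not be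
      open.\<close>
    have "bs \<noteq> []" using bs(1) by (metis list.size(3) power_eq_0_iff zero_neq_numeral)
    then show "\<exists>uv\<in>\<rat> \<times> \<rat>. W uv bs" by (rule W[OF _ bs(2,3)])
  qed
  have "countable (\<rat> \<times> \<rat> :: (real \<times> real) set)" by (intro countable_SIGMA countable_rat)
  from larges_UN[OF this ex_W] obtain uv where uv: "larges r (2 ^ n) (W uv)" by blast
  have less: "fst uv < snd uv" using larges_ex[OF uv] unfolding W_def by blast
  \<comment> \<open>Quantifying over the interval eliminates \<open>t\<close>, so that
    \<open>R\<close> relates points to the \<open>r\<close> remaining parameters.\<close>
  define R where "R b c \<longleftrightarrow> (\<forall>t. fst uv < t \<and> t < snd uv \<longrightarrow> c \<in> U (t # b))" for b c
  have "dfn2 r n R" unfolding dfn2_def R_def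
    by (intro dfn_intros dfn_mem[OF U(1)]) simp_all
  \<comment> \<open>A large set of \<open>b\<close> here, combined with the interval of
    \<open>t\<close>, would put \<open>c\<close> into a large set of members of
    \<open>U\<close>.\<close>
  moreover have "\<not> large r (\<lambda>b. R b c)" for c
  proof
    assume l: "large r (\<lambda>b. R b c)"
    have "large r (\<lambda>b. c \<in> U (t # b))" if "fst uv < t" "t < snd uv" for t
      by (rule large_mono[OF l]) (use that in \<open>simp add: R_def\<close>)
    then have "{fst uv<..<snd uv} \<subseteq> {t. large r (\<lambda>b. c \<in> U (t # b))}" by auto
    moreover have "uncountable {fst uv<..<snd uv}" using less by (simp add: uncountable_open_interval)
    ultimately have "uncountable {t. large r (\<lambda>b. c \<in> U (t # b))}" by (rule uncountable_mono[rotated])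
    then show False using U(3)[of c] by simp
  qed
  moreover have "larges r (2 ^ n) (\<lambda>bs. \<exists>c. length c = n \<and> (\<forall>b\<in>set bs. R b c))"
    by (rule larges_mono[OF uv]) (simp add: W_def R_def)
  ultimately show False using thin_cover[of r n R] by blast
qed

lemma transversable: "transversable r"
  by (induction r) (simp_all add: transversable_0 transversable_Suc)

end

section \<open>Finiteness of countable definable families\<close>

context o_minimal_structure
begin

text \<open>The set \<open>E\<close> of points where \<open>g\<close> is not locally constant is
  definable. If it were infinite it would contain an interval, on which countability of the range
  makes \<open>g\<close> constant on an uncountable definable set, hence on a subinterval. So
  \<open>E\<close> is finite, and \<open>g\<close> is constant on each component of its
  complement.\<close>

lemma finite_range_if_countable:
  fixes g :: "real \<Rightarrow> 'z"
  assumes g: "dfn 2 (\<lambda>e. g (e ! 0) = g (e ! 1))" and c: "countable (range g)"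
  shows "finite (range g)"
proof -
  have g': "dfn k (\<lambda>a. g (f a) = g (h a))" if "sel1 k f" "sel1 k h" for k f h
    using dfn_subst[OF g sel_cons[OF that(1) that(2)[unfolded sel1_def]]] by simp
  define E where "E = {x. \<not> eventually (\<lambda>y. g y = g x) (nhds x)}"
  have "finite E"
  proof (rule ccontr)
    assume "infinite E"
    moreover have "dfn 1 (\<lambda>e. \<not> eventually (\<lambda>y. g y = g (hd e)) (nhds (hd e)))"
      unfolding eventually_nhds_real by (intro dfn_intros g') simp_all
    ultimately obtain p q where pq: "p < q"
      "\<And>y. p < y \<Longrightarrow> y < q \<Longrightarrow> \<not> eventually (\<lambda>z. g z = g y) (nhds y)"
      unfolding E_def using infinite_contains_interval[of "\<lambda>x. \<not> eventually (\<lambda>y. g y = g x) (nhds x)"]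
      by metis
    have "uncountable {p<..<q}" using pq(1) by (simp add: uncountable_open_interval)
    then have unc: "uncountable {x. p < x \<and> x < q}" by (rule uncountable_mono) auto
    obtain z where "uncountable {x. p < x \<and> x < q \<and> g x = z}"
      by (rule uncountable_Collect_ex[OF c unc, of "\<lambda>z x. p < x \<and> x < q \<and> g x = z"]) auto
    then have inf: "infinite {x. p < x \<and> x < q \<and> g x = z}" using countable_finite by blast
    \<comment> \<open>The value \<open>z\<close> has arbitrary type and cannot be a parameter; the
      real \<open>x0\<close> represents it, and only equality of values of \<open>g\<close> is
      definable.\<close>
    then obtain x0 where x0: "g x0 = z" by (metis (mono_tags, lifting) Collect_empty_eq finite.emptyI)
    have "dfn 1 (\<lambda>e. p < hd e \<and> hd e < q \<and> g (hd e) = g x0)"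
      by (intro dfn_intros g') simp_all
    from infinite_contains_interval[OF this inf[folded x0]] obtain u v where uv: "u < v"
      "\<And>y. u < y \<Longrightarrow> y < v \<Longrightarrow> p < y \<and> y < q \<and> g y = g x0" by metis
    obtain w where w: "u < w" "w < v" using uv(1) dense by blast
    have "\<forall>y. u < y \<and> y < v \<longrightarrow> g y = g w"
    proof (intro allI impI)
      fix y assume y: "u < y \<and> y < v"
      have "g y = g x0" using uv(2)[of y] y by blast
      also have "g x0 = g w" using uv(2)[OF w] by (elim conjE) (rule sym)
      finally show "g y = g w" .
    qed
    then have "eventually (\<lambda>y. g y = g w) (nhds w)"
      unfolding eventually_nhds_real using w by blast
    then show False using pq(2)[of w] uv(2)[OF w] by blast
  qed
  \<comment> \<open>Having the same points of \<open>E\<close> below them means that no point of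
    \<open>E\<close> separates \<open>x\<close> from \<open>y\<close>.\<close>
  have const: "g x = g y" if xy: "x < y" "x \<notin> E" "y \<notin> E" "{b\<in>E. b < x} = {b\<in>E. b < y}" for x y
  proof (rule connected_local_const[of "{x..y}"])
    show "\<forall>a\<in>{x..y}. eventually (\<lambda>b. g a = g b) (at a within {x..y})"
    proof
      fix a assume a: "a \<in> {x..y}"
      have "a \<notin> E"
      proof
        assume "a \<in> E"
        then have "a \<in> {b\<in>E. b < y}" using a xy(3) by (cases "a = y") auto
        then have "a < x" unfolding xy(4)[symmetric] by simp
        then show False using a by simp
      qed
      then have "eventually (\<lambda>b. g b = g a) (nhds a)" unfolding E_def by simp
      then have "eventually (\<lambda>b. g a = g b) (nhds a)" by (simp add: eq_commute)
      then show "eventually (\<lambda>b. g a = g b) (at a within {x..y})"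
        unfolding eventually_at_filter by (rule eventually_mono) simp
    qed
  qed (use xy in auto)
  \<comment> \<open>A component of the complement of \<open>E\<close> is labelled by the set of
    points of \<open>E\<close> below it, so there are at most as many components as subsets of
    \<open>E\<close>.\<close>
  define h where "h S = g (SOME x. x \<notin> E \<and> {b\<in>E. b < x} = S)" for S
  have "g ` (- E) \<subseteq> h ` Pow E"
  proof
    fix z assume "z \<in> g ` (- E)"
    then obtain x where x: "x \<notin> E" "z = g x" by blast
    define y where "y = (SOME y. y \<notin> E \<and> {b\<in>E. b < y} = {b\<in>E. b < x})"
    have y: "y \<notin> E \<and> {b\<in>E. b < y} = {b\<in>E. b < x}"
      unfolding y_def by (rule someI[of _ x]) (simp add: x)
    then have y': "y \<notin> E" "{b\<in>E. b < y} = {b\<in>E. b < x}" by blast+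
    have "g x = g y"
    proof (cases x y rule: linorder_cases)
      case less
      from const[OF this x(1) y'(1) y'(2)[symmetric]] show ?thesis .
    next
      case greater
      from const[OF this y'(1) x(1) y'(2)] show ?thesis by (rule sym)
    qed simp
    then have "z = h {b\<in>E. b < x}" using x(2) by (simp add: h_def y_def)
    then show "z \<in> h ` Pow E" by blast
  qed
  then have "finite (g ` (- E))" using \<open>finite E\<close> finite_subset by blast
  moreover have "range g = g ` E \<union> g ` (- E)" by blast
  ultimately show ?thesis using \<open>finite E\<close> by simp
qed

text \<open>Splitting off the first coordinate \<open>x\<close>, the image \<open>g x\<close> of
  each fibre is finite by induction. Equality of these images is definable, so the one-variable case
  leaves only finitely many of them.\<close>

lemma finite_image_if_countable:
  fixes f :: "real list \<Rightarrow> 'z"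
  assumes "dfn m B" "dfn2 m m (\<lambda>a b. f a = f b)" "countable (f ` {a. length a = m \<and> B a})"
  shows "finite (f ` {a. length a = m \<and> B a})"
  using assms
proof (induction m arbitrary: B f)
  case 0
  have "f ` {a. length a = 0 \<and> B a} \<subseteq> {f []}" by auto
  then show ?case using finite_subset by blast
next
  case (Suc m)
  define g where "g x = (\<lambda>a. f (x # a)) ` {a. length a = m \<and> B (x # a)}" for x
  have image: "f ` {a. length a = Suc m \<and> B a} = (\<Union>x. g x)"
  proof (intro set_eqI iffI)
    fix z assume "z \<in> f ` {a. length a = Suc m \<and> B a}"
    then obtain a where "length a = Suc m" "B a" "z = f a" by blast
    then show "z \<in> (\<Union>x. g x)" by (cases a) (auto simp: g_def)
  next
    fix z assume "z \<in> (\<Union>x. g x)"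
    then show "z \<in> f ` {a. length a = Suc m \<and> B a}" by (auto simp: g_def)
  qed
  have fin: "finite (g x)" for x
    unfolding g_def
  proof (rule Suc.IH)
    show "dfn m (\<lambda>a. B (x # a))" by (intro dfn_subst[OF Suc.prems(1)] dfn_intros) simp_all
    show "dfn2 m m (\<lambda>a b. f (x # a) = f (x # b))"
      unfolding dfn2_def by (intro dfn2_subst[OF Suc.prems(2)] dfn_intros) simp_all
    have "(\<lambda>a. f (x # a)) ` {a. length a = m \<and> B (x # a)} \<subseteq> f ` {a. length a = Suc m \<and> B a}"
      by auto
    then show "countable ((\<lambda>a. f (x # a)) ` {a. length a = m \<and> B (x # a)})"
      using Suc.prems(3) countable_subset by blast
  qed
  \<comment> \<open>A countable set has only countably many finite subsets.\<close>
  have "range g \<subseteq> {A. finite A \<and> A \<subseteq> f ` {a. length a = Suc m \<and> B a}}"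
    using fin unfolding image by blast
  then have "countable (range g)"
    using countable_Collect_finite_subset[OF Suc.prems(3)] countable_subset by blast
  moreover have "dfn 2 (\<lambda>e. g (e ! 0) = g (e ! 1))"
  proof -
    have sub: "g x \<subseteq> g y \<longleftrightarrow> (\<forall>a. length a = m \<longrightarrow> B (x # a) \<longrightarrow>
      (\<exists>b. length b = m \<and> B (y # b) \<and> f (x # a) = f (y # b)))" for x y
      unfolding g_def by blast
    have "dfn 2 (\<lambda>e. g (e ! i) \<subseteq> g (e ! j))" if "i < 2" "j < 2" for i j
      unfolding sub
      by (intro dfn_intros dfn_subst[OF Suc.prems(1)] dfn2_subst[OF Suc.prems(2)])
         (use that in simp_all)
    then have "dfn 2 (\<lambda>e. g (e ! 0) \<subseteq> g (e ! 1) \<and> g (e ! 1) \<subseteq> g (e ! 0))"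
      by (intro dfn_conj) simp_all
    then show ?thesis by (rule dfn_cong) blast
  qed
  ultimately have "finite (range g)" by (intro finite_range_if_countable)
  then show ?case unfolding image using fin by auto
qed

lemma finite_definable_family_if_countable:
  assumes "definable_family M n \<A>" "countable \<A>"
  shows "finite \<A>"
proof -
  obtain m B U where *: "dfn m B" "dfn2 m n (\<lambda>b c. c \<in> U b)" "\<A> = U ` {b. length b = m \<and> B b}"
    using assms(1) by (rule definable_familyE)
  \<comment> \<open>For indices outside \<open>B\<close> the set \<open>U b\<close> may contain
    lists of other lengths; trimming makes equality of members a quantifier over
    \<open>n\<close>-tuples.\<close>
  define V where "V b = {c \<in> U b. length c = n}" for b
  have UV: "V b = U b" if "b \<in> {b. length b = m \<and> B b}" for b
  proof -
    have "U b \<in> \<A>" using that unfolding *(3) by blast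
    then have "\<forall>c\<in>U b. length c = n" using assms(1) unfolding definable_family_def by auto
    then show ?thesis unfolding V_def by blast
  qed
  have V: "\<A> = V ` {b. length b = m \<and> B b}" unfolding *(3) by (intro image_cong refl UV[symmetric])
  have "dfn2 m m (\<lambda>a b. \<forall>c. length c = n \<longrightarrow> (c \<in> U a \<longrightarrow> c \<in> U b) \<and> (c \<in> U b \<longrightarrow> c \<in> U a))"
    unfolding dfn2_def by (intro dfn_intros dfn2_subst[OF *(2)]) simp_all
  then have "dfn2 m m (\<lambda>a b. V a = V b)"
    unfolding dfn2_def by (rule dfn_cong) (auto simp: V_def)
  then show ?thesis using finite_image_if_countable[OF *(1)] assms(2) unfolding V by blast
qed

end

section \<open>The equivalence of the three conditions\<close>

lemma (in definably_separable_space) separable: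
  assumes "definable_topological_space M n \<tau>"
  shows "separable_space \<tau>"
proof -
  obtain \<B> where B: "definable_family M n \<B>" "\<forall>A\<in>\<B>. openin \<tau> A"
    "\<forall>W. openin \<tau> W \<longrightarrow> (\<exists>\<B>'\<subseteq>\<B>. W = \<Union>\<B>')"
    using assms unfolding definable_topological_space_def by (elim conjE exE)
  obtain m P U where *: "dfn m P" "dfn2 m n (\<lambda>b c. c \<in> U b)" "\<B> = U ` {b. length b = m \<and> P b}"
    using B(1) by (rule definable_familyE)
  define V where "V b = (if P b then U b else {})" for b
  have "dfn2 m n (\<lambda>b c. P b \<and> c \<in> U b)"
    unfolding dfn2_def by (intro dfn_intros dfn_subst[OF *(1)] dfn2_subst[OF *(2)]) simp_all
  then have "dfn2 m n (\<lambda>b c. c \<in> V b)"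
    unfolding dfn2_def by (rule dfn_cong) (simp add: V_def)
  moreover have "openin \<tau> (V b)" if "length b = m" for b
    using that B(2) unfolding *(3) V_def by auto
  ultimately have "open_family m V" unfolding open_family_def by blast
  from transversable[unfolded transversable_def, THEN spec, THEN mp, OF this]
  obtain D where D: "countable D" "\<forall>b. length b = m \<longrightarrow> V b \<noteq> {} \<longrightarrow> V b \<inter> D \<noteq> {}"
    by (elim exE conjE)
  have hit: "W \<inter> D \<noteq> {}" if W: "openin \<tau> W" "W \<noteq> {}" for W
  proof -
    obtain \<B>' where "\<B>' \<subseteq> \<B>" "W = \<Union>\<B>'" using B(3) W(1) by blast
    then obtain A where "A \<in> \<B>" "A \<noteq> {}" "A \<subseteq> W" using W(2) by blast
    then obtain b where "length b = m" "P b" "A = U b" unfolding *(3) by blast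
    then have "length b = m" "A = V b" by (simp_all add: V_def)
    then show ?thesis using D(2)[THEN spec, of b] \<open>A \<noteq> {}\<close> \<open>A \<subseteq> W\<close> by blast
  qed
  \<comment> \<open>Every nonempty open set contains a nonempty basic set and so meets
    \<open>D\<close>; a dense set must also lie in the space, hence the intersection.\<close>
  have "\<tau> closure_of (topspace \<tau> \<inter> D) = topspace \<tau>"
  proof (intro equalityI closure_of_subset_topspace subsetI)
    fix x assume "x \<in> topspace \<tau>"
    moreover have "\<exists>y. y \<in> topspace \<tau> \<inter> D \<and> y \<in> W" if "x \<in> W" "openin \<tau> W" for W
      using hit[of W] that openin_subset[of \<tau> W] by blast
    ultimately show "x \<in> \<tau> closure_of (topspace \<tau> \<inter> D)" unfolding in_closure_of by blast
  qed
  then show ?thesis unfolding separable_space_def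
    using D(1) by (intro exI[of _ "topspace \<tau> \<inter> D"]) (auto intro: countable_Int2)
qed

text \<open>Choosing a point of a countable dense set in each nonempty member is injective on a
  disjoint family.\<close>

lemma countable_chain_condition_if_separable:
  assumes "separable_space \<tau>"
  shows "countable_chain_condition \<tau>"
  unfolding countable_chain_condition_def
proof (rule notI, elim exE conjE)
  fix \<A> assume A: "uncountable \<A>" "pairwise disjnt \<A>" "\<forall>A\<in>\<A>. openin \<tau> A"
  obtain D where D: "countable D" "\<tau> closure_of D = topspace \<tau>"
    using assms unfolding separable_space_def by blast
  have ex: "\<exists>d. d \<in> D \<and> d \<in> A" if mem: "A \<in> \<A> - {{}}" for A
  proof -
    obtain x where "x \<in> A" using mem by blast
    moreover have "openin \<tau> A" using mem A(3) by blast
    ultimately have "x \<in> \<tau> closure_of D" using D(2) openin_subset by blast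
    then show ?thesis using \<open>x \<in> A\<close> \<open>openin \<tau> A\<close> unfolding in_closure_of by blast
  qed
  define pt where "pt A = (SOME d. d \<in> D \<and> d \<in> A)" for A
  have pt: "pt A \<in> D" "pt A \<in> A" if "A \<in> \<A> - {{}}" for A
    using someI_ex[OF ex[OF that]] unfolding pt_def by simp_all
  have "inj_on pt (\<A> - {{}})"
  proof (rule inj_onI, rule ccontr)
    fix A B assume *: "A \<in> \<A> - {{}}" "B \<in> \<A> - {{}}" "pt A = pt B" "A \<noteq> B"
    then have "disjnt A B" using A(2) unfolding pairwise_def by blast
    then show False using pt(2)[OF *(1)] pt(2)[OF *(2)] *(3) unfolding disjnt_def by auto
  qed
  moreover have "countable (pt ` (\<A> - {{}}))"
    by (rule countable_subset[OF _ D(1)]) (use pt(1) in blast)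
  ultimately have "countable (\<A> - {{}})" using countable_image_inj_on by blast
  then show False using A(1) uncountable_minus_countable[of \<A> "{{}}"] by simp
qed

theorem theorem4p7:
  fixes M :: "('f, 'r) real_structure"
    and n :: nat
    and \<tau> :: "real list topology"
  assumes "o_minimal M"
    and "definable_topological_space M n \<tau>"
  shows "(definably_separable M n \<tau> \<longleftrightarrow> separable_space \<tau>) \<and>
         (separable_space \<tau> \<longleftrightarrow> countable_chain_condition \<tau>)"
proof -
  interpret o_minimal_structure M by standard (rule assms(1))
  have "separable_space \<tau>" if sep: "definably_separable M n \<tau>"
  proof -
    interpret definably_separable_space M n \<tau>
      by standard (use assms(2) sep in \<open>simp_all add: definable_topological_space_def\<close>)
    show ?thesis by (rule separable[OF assms(2)])
  qed
  \<comment> \<open>An infinite definable family is uncountable, so a disjoint open one would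
    violate the chain condition.\<close>
  moreover have "definably_separable M n \<tau>" if "countable_chain_condition \<tau>"
    using that finite_definable_family_if_countable
    unfolding definably_separable_def countable_chain_condition_def by blast
  ultimately show ?thesis using countable_chain_condition_if_separable[of \<tau>] by blast
qed

end
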